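(* Let $f:\mathbb R^n\to\mathbb R^n$ ($n\ge 2$) be smooth, let $x^\star$ be a non-trivial $T$-periodic solution of $\dot x=f(x)$ (with $T>0$ its minimal period) such that $f(x^\star(t))\ne0$ for all $t$, and let $z(\cdot)$, $\Pi(\cdot)$ be as in the context. Suppose there exists a continuously differentiable function $V(x_\perp,\tau)$ of $x_\perp\in\mathbb R^{n-1}$ and $\tau\in\mathbb R$, $T$-periodic in $\tau$ (so regarded as a function on $\mathbb R^{n-1}\times(\mathbb R/T\mathbb Z)$), such that $$D:=\{(x_\perp,\tau)\in\mathbb R^{n-1}\times(\mathbb R/T\mathbb Z): V(x_\perp,\tau)\le 1\}$$ is compact and the following hold for all $(x_\perp,\tau)\in D$: $$V(x_\perp,\tau)>0\ \text{ if } x_\perp\neq0,$$ $$\frac{d}{dt}V(x_\perp,\tau)<0\ \text{ if } x_\perp\ne0,$$ $$V(0,\tau)=\frac{d}{dt}V(0,\tau)=0,$$ $$z(\tau)^\top f(x^\star(\tau))-\Big(\frac{d z(\tau)}{d\tau}\Big)^{\!\top}\Pi(\tau)^\top x_\perp>0.$$ Then $D$ is an inner estimate of the region of orbital stability of $x^\star(\cdot)$; that is, the set $R=\{x^\star(\tau)+\Pi(\tau)^\top x_\perp:(x_\perp,\tau)\in D\}\subset\mathbb R^n$ is an inner estimate of the region of stability of $x^\star(\cdot)$.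
   Context: Vectors are columns and $^\top$ denotes transpose. $\Phi(x_0,t)$ denotes the solution at time $t$ of $\dot x=f(x)$, $x(0)=x_0$. $\Gamma^\star=\{x^\star(t):t\in[0,T)\}$, and $\operatorname{dist}(x,\Gamma^\star)=\inf_{y\in\Gamma^\star}|y-x|$ (Euclidean norm). A set $R\subset\mathbb R^n$ with non-empty interior $R^i$ and $\Gamma^\star\subset R^i$ is an inner estimate of the region of stability of $x^\star(\cdot)$ if for all $x_0\in R$ we have $\operatorname{dist}(\Phi(x_0,t),\Gamma^\star)\to0$ as $t\to\infty$. Transversal normal field: $z:\mathbb R\to\mathbb R^n$ is a smooth $T$-periodic function with bounded derivative, $\|z(\tau)\|=1$, and $z(\tau)^\top f(x^\star(\tau))>\delta$ for all $\tau$ and some $\delta>0$. Projection operator: for $n\ge3$, fix an orthonormal basis $\eta_1,\dots,\eta_n$ of $\mathbb R^n$ such that $\eta_1$ is not collinear with $z(\tau)$ for any $\tau$, and set $\xi_j(\tau)=\eta_j-\frac{\eta_j^\top z(\tau)}{1+\eta_1^\top z(\tau)}(\eta_1+z(\tau))$ for $j=2,\dots,n$; for $n=2$ set $\xi_2(\tau)=(-z_2(\tau),z_1(\tau))^\top$. $\Pi(\tau)$ is the $(n-1)\times n$ matrix with rows $\xi_2(\tau)^\top,\dots,\xi_n(\tau)^\top$. Transverse dynamics: in the coordinates $(x_\perp,\tau)$, with $x=x^\star(\tau)+\Pi(\tau)^\top x_\perp$, the system $\dot x=f(x)$ reads $$\dot\tau=\frac{z(\tau)^\top f(x^\star(\tau)+\Pi(\tau)^\top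 x_\perp)}{z(\tau)^\top f(x^\star(\tau))-\big(\frac{dz(\tau)}{d\tau}\big)^\top\Pi(\tau)^\top x_\perp},$$ $$\dot x_\perp=\dot\tau\Big[\frac{d}{d\tau}\Pi(\tau)\Big]\Pi(\tau)^\top x_\perp+\Pi(\tau)f(x^\star(\tau)+\Pi(\tau)^\top x_\perp)-\Pi(\tau)f(x^\star(\tau))\dot\tau,$$ and $\frac{d}{dt}V(x_\perp,\tau)=\frac{\partial V}{\partial\tau}\dot\tau+\frac{\partial V}{\partial x_\perp}\dot x_\perp$ with these expressions for $\dot\tau,\dot x_\perp$.
   Formalization: The set D is additionally assumed to be non-empty: for example with V ≡ 2 the set D is empty, all the conditions hold vacuously, and the conclusion fails because R is empty. *)

theory Defs
  imports "HOL-Analysis.Analysis"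
begin

text \<open>
  \<open>k\<close> times continuously differentiable on the whole space. In the recursive clause the
  directional derivatives \<open>x \<mapsto> f' x v\<close> must be \<open>k\<close> times continuously differentiable; in finite
  dimension this says the same about \<open>x \<mapsto> f' x\<close> as a map into the linear maps.
\<close>

fun Ck :: "nat \<Rightarrow> ('a::euclidean_space \<Rightarrow> 'b::real_normed_vector) \<Rightarrow> bool" where
  "Ck 0 f \<longleftrightarrow> continuous_on UNIV f"
| "Ck (Suc k) f \<longleftrightarrow>
     (\<exists>f'. (\<forall>x. (f has_derivative f' x) (at x)) \<and> (\<forall>v. Ck k (\<lambda>x. f' x v)))"

definition smooth :: "('a::euclidean_space \<Rightarrow> 'b::real_normed_vector) \<Rightarrow> bool" where
  "smooth f \<longleftrightarrow> (\<forall>k. Ck k f)"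

definition periodic :: "real \<Rightarrow> (real \<Rightarrow> 'a) \<Rightarrow> bool" where
  "periodic T g \<longleftrightarrow> (\<forall>t. g (t + T) = g t)"

definition solution_on ::
  "('a::real_normed_vector \<Rightarrow> 'a) \<Rightarrow> (real \<Rightarrow> 'a) \<Rightarrow> real set \<Rightarrow> bool" where
  "solution_on f \<phi> S \<longleftrightarrow> (\<forall>t\<in>S. (\<phi> has_vector_derivative f (\<phi> t)) (at t within S))"

text \<open>
  \<open>flow f x0 t\<close> is meaningful for \<open>t \<ge> 0\<close>, when the solution from \<open>x0\<close> exists on \<open>{0..t}\<close>
  and is unique there (as it is for smooth \<open>f\<close>).
\<close>

definition flow :: "('a::real_normed_vector \<Rightarrow> 'a) \<Rightarrow> 'a \<Rightarrow> real \<Rightarrow> 'a" where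
  "flow f x0 t = (THE y. \<exists>\<phi>. solution_on f \<phi> {0..t} \<and> \<phi> 0 = x0 \<and> \<phi> t = y)"

definition nontrivial_periodic_solution ::
  "('a::real_normed_vector \<Rightarrow> 'a) \<Rightarrow> real \<Rightarrow> (real \<Rightarrow> 'a) \<Rightarrow> bool" where
  "nontrivial_periodic_solution f T xs \<longleftrightarrow>
     solution_on f xs UNIV \<and> (\<exists>s t. xs s \<noteq> xs t) \<and>
     T > 0 \<and> periodic T xs \<and> (\<forall>S. 0 < S \<and> S < T \<longrightarrow> \<not> periodic S xs)"

definition orbit :: "real \<Rightarrow> (real \<Rightarrow> 'a) \<Rightarrow> 'a set" where
  "orbit T xs = xs ` {0..<T}"

text \<open>
  The vector field need not be complete, so \<open>dist (\<Phi>(x0,t), \<Gamma>) \<longrightarrow> 0\<close> as \<open>t \<longrightarrow> \<infinity>\<close> includes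
  that the solution from \<open>x0\<close> exists for all \<open>t \<ge> 0\<close>.
\<close>

definition inner_estimate_region_of_stability ::
  "('a::euclidean_space \<Rightarrow> 'a) \<Rightarrow> real \<Rightarrow> (real \<Rightarrow> 'a) \<Rightarrow> 'a set \<Rightarrow> bool" where
  "inner_estimate_region_of_stability f T xs R \<longleftrightarrow>
     interior R \<noteq> {} \<and> orbit T xs \<subseteq> interior R \<and>
     (\<forall>x0\<in>R. (\<exists>\<phi>. solution_on f \<phi> {0..} \<and> \<phi> 0 = x0) \<and>
        ((\<lambda>t. infdist (flow f x0 t) (orbit T xs)) \<longlongrightarrow> 0) at_top)"

definition transversal_normal_field ::
  "('a::euclidean_space \<Rightarrow> 'a) \<Rightarrow> real \<Rightarrow> (real \<Rightarrow> 'a) \<Rightarrow> (real \<Rightarrow> 'a) \<Rightarrow> bool" where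
  "transversal_normal_field f T xs z \<longleftrightarrow>
     smooth z \<and> periodic T z \<and> bounded (range (\<lambda>\<tau>. vector_derivative z (at \<tau>))) \<and>
     (\<forall>\<tau>. norm (z \<tau>) = 1) \<and> (\<exists>\<delta>>0. \<forall>\<tau>. z \<tau> \<bullet> f (xs \<tau>) > \<delta>)"

definition orthonormal_basis :: "(nat \<Rightarrow> real^'n) \<Rightarrow> bool" where
  "orthonormal_basis \<eta> \<longleftrightarrow>
     (\<forall>i\<in>{1..CARD('n)}. \<forall>j\<in>{1..CARD('n)}. \<eta> i \<bullet> \<eta> j = (if i = j then 1 else 0)) \<and>
     span (\<eta> ` {1..CARD('n)}) = UNIV"

text \<open>
  With \<open>n = CARD('n)\<close>, the \<open>i\<close>-th coordinate of a vector \<open>v\<close> is \<open>v $ e i\<close> for an enumeration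
  \<open>e\<close> of the index type by \<open>{1..n}\<close>. It is needed only in the plane, where \<open>xi\<close> is the
  vector \<open>(- z_2, z_1)\<close>. The \<open>n - 1\<close> rows of the projection operator are indexed by a type
  \<open>'m\<close>, and the row \<open>k\<close> carries the number \<open>r k\<close> in \<open>{2..n}\<close>.
\<close>

definition xi ::
  "(nat \<Rightarrow> 'n::finite) \<Rightarrow> (nat \<Rightarrow> real^'n) \<Rightarrow> (real \<Rightarrow> real^'n) \<Rightarrow> nat \<Rightarrow> real \<Rightarrow> real^'n" where
  "xi e \<eta> z j \<tau> =
     (if CARD('n) = 2
      then (\<chi> i. if i = e 1 then - (z \<tau> $ e 2) else z \<tau> $ e 1)
      else \<eta> j - ((\<eta> j \<bullet> z \<tau>) / (1 + \<eta> 1 \<bullet> z \<tau>)) *\<^sub>R (\<eta> 1 + z \<tau>))"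

definition projection_operator ::
  "(nat \<Rightarrow> 'n::finite) \<Rightarrow> ('m::finite \<Rightarrow> nat) \<Rightarrow> (nat \<Rightarrow> real^'n) \<Rightarrow> (real \<Rightarrow> real^'n) \<Rightarrow>
   real \<Rightarrow> real^'n^'m" where
  "projection_operator e r \<eta> z \<tau> = (\<chi> k. xi e \<eta> z (r k) \<tau>)"

definition transverse_point ::
  "(real \<Rightarrow> real^'n) \<Rightarrow> (real \<Rightarrow> real^'n^'m) \<Rightarrow> real^'m \<Rightarrow> real \<Rightarrow> real^'n" where
  "transverse_point xs P x \<tau> = xs \<tau> + transpose (P \<tau>) *v x"

definition transverse_denominator ::
  "(real^'n \<Rightarrow> real^'n) \<Rightarrow> (real \<Rightarrow> real^'n) \<Rightarrow> (real \<Rightarrow> real^'n) \<Rightarrow> (real \<Rightarrow> real^'n^'m) \<Rightarrow>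
   real^'m \<Rightarrow> real \<Rightarrow> real" where
  "transverse_denominator f xs z P x \<tau> =
     z \<tau> \<bullet> f (xs \<tau>) - vector_derivative z (at \<tau>) \<bullet> (transpose (P \<tau>) *v x)"

definition tau_dot ::
  "(real^'n \<Rightarrow> real^'n) \<Rightarrow> (real \<Rightarrow> real^'n) \<Rightarrow> (real \<Rightarrow> real^'n) \<Rightarrow> (real \<Rightarrow> real^'n^'m) \<Rightarrow>
   real^'m \<Rightarrow> real \<Rightarrow> real" where
  "tau_dot f xs z P x \<tau> =
     (z \<tau> \<bullet> f (transverse_point xs P x \<tau>)) / transverse_denominator f xs z P x \<tau>"

definition perp_dot ::
  "(real^'n \<Rightarrow> real^'n) \<Rightarrow> (real \<Rightarrow> real^'n) \<Rightarrow> (real \<Rightarrow> real^'n) \<Rightarrow> (real \<Rightarrow> real^'n^'m) \<Rightarrow>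
   real^'m \<Rightarrow> real \<Rightarrow> real^'m" where
  "perp_dot f xs z P x \<tau> =
     tau_dot f xs z P x \<tau> *\<^sub>R (vector_derivative P (at \<tau>) *v (transpose (P \<tau>) *v x))
     + P \<tau> *v f (transverse_point xs P x \<tau>)
     - tau_dot f xs z P x \<tau> *\<^sub>R (P \<tau> *v f (xs \<tau>))"

definition dV_dt ::
  "(real^'n \<Rightarrow> real^'n) \<Rightarrow> (real \<Rightarrow> real^'n) \<Rightarrow> (real \<Rightarrow> real^'n) \<Rightarrow> (real \<Rightarrow> real^'n^'m) \<Rightarrow>
   ((real^'m) \<times> real \<Rightarrow> real) \<Rightarrow> real^'m \<Rightarrow> real \<Rightarrow> real" where
  "dV_dt f xs z P V x \<tau> =
     deriv (\<lambda>\<sigma>. V (x, \<sigma>)) \<tau> * tau_dot f xs z P x \<tau>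
     + frechet_derivative (\<lambda>y. V (y, \<tau>)) (at x) (perp_dot f xs z P x \<tau>)"

definition circle_class :: "real \<Rightarrow> real \<Rightarrow> real set" where
  "circle_class T \<tau> = {\<tau> + of_int k * T | k :: int. True}"

definition circle_topology :: "real \<Rightarrow> real set topology" where
  "circle_topology T =
     topology (\<lambda>U. U \<subseteq> range (circle_class T) \<and> open (circle_class T -` U))"

lemma openin_circle_topology:
  "openin (circle_topology T) U \<longleftrightarrow> U \<subseteq> range (circle_class T) \<and> open (circle_class T -` U)"
proof -
  have "istopology (\<lambda>U. U \<subseteq> range (circle_class T) \<and> open (circle_class T -` U))"
    unfolding istopology_def by (auto simp: vimage_Int vimage_Union intro!: open_Int open_UN)
  then show ?thesis
    by (simp add: circle_topology_def)
qed

lemma topspace_circle_topology: "topspace (circle_topology T) = range (circle_class T)"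
proof
  show "topspace (circle_topology T) \<subseteq> range (circle_class T)"
    using openin_circle_topology openin_topspace by blast
  have "openin (circle_topology T) (range (circle_class T))"
    by (simp add: openin_circle_topology vimage_def)
  then show "range (circle_class T) \<subseteq> topspace (circle_topology T)"
    by (rule openin_subset)
qed

lemma quotient_map_circle_class: "quotient_map euclidean (circle_topology T) (circle_class T)"
  unfolding quotient_map_def
  by (auto simp: topspace_circle_topology openin_circle_topology vimage_def)

definition unit_sublevel :: "real \<Rightarrow> ('a \<times> real \<Rightarrow> real) \<Rightarrow> ('a \<times> real set) set" where
  "unit_sublevel T V = {(x, circle_class T \<tau>) | x \<tau>. V (x, \<tau>) \<le> 1}"

end

theory Submission
  imports Defs "HOL-Complex_Analysis.Great_Picard"
begin

text \<open>
  The coordinates \<open>(x, \<tau>) \<mapsto> x\<^sup>\<star>(\<tau>) + \<Pi>(\<tau>)\<^sup>T x\<close> form a chart around the orbit. Differentiating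
  the orthonormality relations of the moving frame \<open>(z, \<Pi>)\<close> shows that the derivative of the chart is
  invertible exactly where the denominator of \<open>\<tau>'\<close> is nonzero, and that it carries the
  transverse vector field to \<open>f\<close> (\<open>chart_deriv_field\<close>). Hence a curve in \<open>{V \<le> 1}\<close> that solves
  the transverse system is mapped to a solution of \<open>x' = f x\<close>.

  Such curves exist for all positive times. The transverse field is only needed on the closed set
  \<open>{V \<le> 1}\<close>, where it is continuous and, by periodicity and compactness, bounded. Its Tietze
  extension is a bounded continuous field on the whole space, so Peano's theorem
  (\<open>Peano_existence\<close>) gives a solution on every interval \<open>[0, b]\<close>. On the level \<open>V = 1\<close>
  the point is off the orbit, so \<open>V\<close> decreases strictly there, and the solution never leaves
  \<open>{V \<le> 1}\<close> (\<open>barrier_stays_below\<close>); it therefore never sees the extension. Peano's theorem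
  gives no uniqueness, but none is wanted in these coordinates: \<open>f\<close> itself is locally Lipschitz, so
  the images of all these curves are pieces of the one solution \<open>t \<mapsto> \<Phi>(x\<^sub>0, t)\<close>.

  Away from the orbit the rate of change of \<open>V\<close> is bounded above by a negative constant, again by
  compactness modulo the period. As \<open>V\<close> lies between 0 and 1 on the
  sublevel set, it drops below any given
  \<open>\<epsilon>\<close> within a time that depends on \<open>\<epsilon>\<close> alone (\<open>V_small_along_trajectory\<close>); small values
  of \<open>V\<close> force small \<open>|x|\<close>, and \<open>|x|\<close> bounds the distance to the orbit. Finally the orbit lies in
  the interior of the estimate because the chart is an open map at its points
  (\<open>chart_interior\<close>).
\<close>

section \<open>Ordinary differential equations\<close>

lemma deriv_le_imp_decrease:
  fixes u :: "real \<Rightarrow> real"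
  assumes "a \<le> b"
    and deriv: "\<And>s. s \<in> {a..b} \<Longrightarrow> (u has_real_derivative u' s) (at s within {a..b})"
    and le: "\<And>s. s \<in> {a..b} \<Longrightarrow> u' s \<le> - c"
  shows "u b \<le> u a - c * (b - a)"
proof -
  obtain s where s: "s \<in> {a..b}" "u b - u a = u' s * (b - a)"
    using mvt_very_simple[OF \<open>a \<le> b\<close>, of u "\<lambda>s. (*) (u' s)"] deriv
    by (auto simp: has_field_derivative_def)
  have "u' s * (b - a) \<le> (- c) * (b - a)"
    using le[OF s(1)] \<open>a \<le> b\<close> by (intro mult_right_mono) auto
  then show ?thesis
    using s(2) by simp
qed

lemma Ck_1E:
  assumes "Ck 1 f"
  obtains f' where "\<And>x. (f has_derivative f' x) (at x)" "\<And>v. continuous_on UNIV (\<lambda>x. f' x v)"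
  using assms by (auto simp: One_nat_def)

text \<open>
  Only the directional derivatives are known to be continuous, so the operator norm
  is bounded by the sum of their norms over a basis.
\<close>

lemma C1_lipschitz_on_cball:
  fixes f :: "'a::euclidean_space \<Rightarrow> 'b::real_normed_vector"
  assumes f': "\<And>x. (f has_derivative f' x) (at x)"
    and cont: "\<And>v. continuous_on UNIV (\<lambda>x. f' x v)"
  obtains L where "L \<ge> 0"
    "\<And>x y. x \<in> cball a r \<Longrightarrow> y \<in> cball a r \<Longrightarrow> norm (f x - f y) \<le> L * norm (x - y)"
proof -
  let ?g = "\<lambda>x. \<Sum>b\<in>Basis. norm (f' x b)"
  have "continuous_on (cball a r) ?g"
    using cont by (auto intro!: continuous_intros intro: continuous_on_subset)
  then have "bounded (?g ` cball a r)"
    by (intro compact_imp_bounded compact_continuous_image) auto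
  then obtain L where L: "\<forall>x\<in>cball a r. norm (?g x) \<le> L" "L > 0"
    unfolding bounded_pos by blast
  show thesis
  proof
    show "L \<ge> 0" using L(2) by simp
    fix x y assume xy: "x \<in> cball a r" "y \<in> cball a r"
    show "norm (f x - f y) \<le> L * norm (x - y)"
    proof (rule differentiable_bound[where S = "cball a r"])
      fix x assume x: "x \<in> cball a r"
      show "(f has_derivative f' x) (at x within cball a r)"
        using f' has_derivative_at_withinI by blast
      have "onorm (f' x) \<le> ?g x"
        using f' has_derivative_bounded_linear by (intro onorm_componentwise) blast
      then show "onorm (f' x) \<le> L"
        using L(1) x by fastforce
    qed (use xy in auto)
  qed
qed

text \<open>
  With a Lipschitz constant \<open>L\<close> on a ball that contains both curves,
  \<open>|\<phi> - \<psi>|\<^sup>2 exp (-2Ls)\<close> is non-increasing and vanishes at 0.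
\<close>

lemma solution_unique:
  fixes f :: "'a::euclidean_space \<Rightarrow> 'a"
  assumes f: "Ck 1 f"
    and \<phi>: "solution_on f \<phi> {0..b}" and \<psi>: "solution_on f \<psi> {0..b}"
    and eq: "\<phi> 0 = \<psi> 0" and t: "t \<in> {0..b}"
  shows "\<phi> t = \<psi> t"
proof -
  obtain f' where f': "\<And>x. (f has_derivative f' x) (at x)" "\<And>v. continuous_on UNIV (\<lambda>x. f' x v)"
    using f by (rule Ck_1E) blast
  have "continuous_on {0..b} \<phi>" "continuous_on {0..b} \<psi>"
    using \<phi> \<psi> unfolding solution_on_def continuous_on_eq_continuous_within
    by (blast intro: has_vector_derivative_continuous)+
  then have "bounded (\<phi> ` {0..b} \<union> \<psi> ` {0..b})"
    by (auto intro!: compact_imp_bounded compact_continuous_image)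
  then obtain r where r: "\<phi> ` {0..b} \<union> \<psi> ` {0..b} \<subseteq> cball 0 r"
    by (auto simp: bounded_iff subset_iff)
  obtain L where L: "L \<ge> 0"
    "\<And>x y. x \<in> cball 0 r \<Longrightarrow> y \<in> cball 0 r \<Longrightarrow> norm (f x - f y) \<le> L * norm (x - y)"
    using C1_lipschitz_on_cball[OF f', of 0 r] by blast
  \<comment> \<open>the weight turns Gronwall's inequality into monotonicity\<close>
  define u where "u s = (\<phi> s - \<psi> s) \<bullet> (\<phi> s - \<psi> s) * exp (- 2 * L * s)" for s
  define u' where "u' s = 2 * ((f (\<phi> s) - f (\<psi> s)) \<bullet> (\<phi> s - \<psi> s)
      - L * ((\<phi> s - \<psi> s) \<bullet> (\<phi> s - \<psi> s))) * exp (- 2 * L * s)" for s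
  have "(u has_real_derivative u' s) (at s within {0..b})" if "s \<in> {0..b}" for s
  proof -
    have "((\<lambda>s. \<phi> s - \<psi> s) has_vector_derivative f (\<phi> s) - f (\<psi> s)) (at s within {0..b})"
      using \<phi> \<psi> that unfolding solution_on_def by (auto intro!: derivative_intros)
    from bounded_bilinear.has_vector_derivative[OF bounded_bilinear_inner this this]
    have "((\<lambda>s. (\<phi> s - \<psi> s) \<bullet> (\<phi> s - \<psi> s)) has_real_derivative
        2 * ((f (\<phi> s) - f (\<psi> s)) \<bullet> (\<phi> s - \<psi> s))) (at s within {0..b})"
      by (simp add: has_real_derivative_iff_has_vector_derivative inner_commute)
    moreover have "((\<lambda>s. exp (- 2 * L * s)) has_real_derivative - 2 * L * exp (- 2 * L * s)) (at s within {0..b})"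
      by (auto intro!: derivative_eq_intros)
    ultimately show ?thesis
      unfolding u_def u'_def
      by (rule DERIV_cong[OF DERIV_mult]) (simp add: algebra_simps)
  qed
  moreover have "u' s \<le> 0" if "s \<in> {0..b}" for s
  proof -
    have "(f (\<phi> s) - f (\<psi> s)) \<bullet> (\<phi> s - \<psi> s) \<le> norm (f (\<phi> s) - f (\<psi> s)) * norm (\<phi> s - \<psi> s)"
      by (rule norm_cauchy_schwarz)
    also have "\<dots> \<le> L * norm (\<phi> s - \<psi> s) * norm (\<phi> s - \<psi> s)"
      using L(2) r that by (intro mult_right_mono) (auto simp: image_subset_iff)
    also have "\<dots> = L * ((\<phi> s - \<psi> s) \<bullet> (\<phi> s - \<psi> s))"
      by (simp add: dot_square_norm power2_eq_square)
    finally show ?thesis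
      unfolding u'_def by (simp add: mult_le_0_iff)
  qed
  ultimately have "u t \<le> u 0"
    using t deriv_le_imp_decrease[of 0 t u u' 0]
    by (force intro: has_field_derivative_subset)
  then have "(\<phi> t - \<psi> t) \<bullet> (\<phi> t - \<psi> t) \<le> 0"
    using eq by (simp add: u_def mult_le_0_iff)
  then show ?thesis
    by (simp add: dot_square_norm)
qed

lemma solution_on_subset:
  assumes "solution_on f \<phi> S" and sub: "S' \<subseteq> S"
  shows "solution_on f \<phi> S'"
  unfolding solution_on_def
proof
  fix t assume "t \<in> S'"
  then have "(\<phi> has_vector_derivative f (\<phi> t)) (at t within S)"
    using assms by (auto simp: solution_on_def)
  then show "(\<phi> has_vector_derivative f (\<phi> t)) (at t within S')"
    using sub by (rule has_vector_derivative_within_subset)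
qed

lemma flow_eq_solution:
  fixes f :: "'a::euclidean_space \<Rightarrow> 'a"
  assumes f: "Ck 1 f" and \<phi>: "solution_on f \<phi> {0..b}" and t: "t \<in> {0..b}"
  shows "flow f (\<phi> 0) t = \<phi> t"
  unfolding flow_def
proof (rule the_equality)
  have sol: "solution_on f \<phi> {0..t}"
    using solution_on_subset[OF \<phi>, of "{0..t}"] t by simp
  then show "\<exists>\<psi>. solution_on f \<psi> {0..t} \<and> \<psi> 0 = \<phi> 0 \<and> \<psi> t = \<phi> t"
    by blast
  show "y = \<phi> t" if "\<exists>\<psi>. solution_on f \<psi> {0..t} \<and> \<psi> 0 = \<phi> 0 \<and> \<psi> t = y" for y
  proof -
    from that obtain \<psi> where "solution_on f \<psi> {0..t}" "\<psi> 0 = \<phi> 0" "\<psi> t = y" by blast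
    then show ?thesis
      using solution_unique[OF f _ sol, of \<psi> t] t by simp
  qed
qed

text \<open>
  By uniqueness the solutions on the various compact intervals are restrictions of each other,
  so solutions of every finite length already give a global one.
\<close>

lemma flow_is_solution:
  fixes f :: "'a::euclidean_space \<Rightarrow> 'a"
  assumes f: "Ck 1 f"
    and ex: "\<And>b. b > 0 \<Longrightarrow> \<exists>\<phi>. solution_on f \<phi> {0..b} \<and> \<phi> 0 = x0"
  shows "solution_on f (flow f x0) {0..}" and "flow f x0 0 = x0"
proof -
  show "solution_on f (flow f x0) {0..}"
    unfolding solution_on_def
  proof
    fix t :: real assume t: "t \<in> {0..}"
    then obtain \<phi> where \<phi>: "solution_on f \<phi> {0..t + 1}" "\<phi> 0 = x0"
      using ex[of "t + 1"] by auto
    have flow_eq: "flow f x0 s = \<phi> s" if "s \<in> {0..t + 1}" for s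
      using flow_eq_solution[OF f \<phi>(1) that] \<phi>(2) by simp
    have "(\<phi> has_vector_derivative f (\<phi> t)) (at t within {0..t + 1})"
      using \<phi> t by (auto simp: solution_on_def)
    then have "(flow f x0 has_vector_derivative f (\<phi> t)) (at t within {0..t + 1})"
      by (rule has_vector_derivative_transform[rotated 2]) (use t flow_eq in simp_all)
    then have "(flow f x0 has_vector_derivative f (flow f x0 t)) (at t within {0..t + 1})"
      using t flow_eq[of t] by simp
    moreover have "at t within {0..} = at t within {0..t + 1}"
      using t by (intro at_within_nhd[of _ "{..<t + 1}"]) auto
    ultimately show "(flow f x0 has_vector_derivative f (flow f x0 t)) (at t within {0..})"
      by simp
  qed
  obtain \<phi> where \<phi>: "solution_on f \<phi> {0..1}" "\<phi> 0 = x0"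
    using ex[of 1] by auto
  then show "flow f x0 0 = x0"
    using flow_eq_solution[OF f \<phi>(1), of 0] by simp
qed

text \<open>
  Tonelli's approximation of an initial value problem. With a delay the right-hand side at time \<open>t\<close>
  uses only the past up to \<open>t - h\<close>, so Picard iteration becomes stationary: the \<open>j\<close>-th iterate is
  final on the times up to \<open>j h\<close>.
\<close>

lemma delayed_solution_exists:
  fixes G :: "'a::euclidean_space \<Rightarrow> 'a" and h b :: real
  assumes G: "continuous_on UNIV G" and h: "h > 0"
  shows "\<exists>y. continuous_on UNIV y \<and> (\<forall>t\<le>0. y t = p)
    \<and> (\<forall>t\<in>{0..b}. y t = p + integral {0..t} (\<lambda>s. G (y (s - h))))"
proof -
  define step where "step y t = p + integral {0..t} (\<lambda>s. G (y (s - h)))" for y :: "real \<Rightarrow> 'a" and t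
  define Y where "Y j = (step ^^ j) (\<lambda>_. p)" for j
  have Y_Suc: "Y (Suc j) = step (Y j)" for j
    by (simp add: Y_def)
  have past: "Y j t = p" if "t \<le> 0" for j t
  proof (cases j)
    case (Suc i)
    have "{0..t} = {} \<or> t = 0" using that by auto
    then show ?thesis unfolding Suc Y_Suc step_def by auto
  qed (simp add: Y_def)
  have cont: "continuous_on UNIV (Y j)" for j
  proof (induction j)
    case (Suc j)
    have "continuous_on {0..} (Y (Suc j))"
      unfolding continuous_on_eq_continuous_within
    proof
      fix t :: real assume t: "t \<in> {0..}"
      have "continuous_on UNIV (\<lambda>s. G (Y j (s - h)))"
        by (intro continuous_on_compose2[OF G, of _ "\<lambda>s. Y j (s - h)"]
            continuous_on_compose2[OF Suc, of _ "\<lambda>s. s - h"] continuous_intros subset_UNIV)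
      then have "((\<lambda>u. integral {0..u} (\<lambda>s. G (Y j (s - h)))) has_vector_derivative G (Y j (t - h)))
          (at t within {0..t + 1})"
        using t by (intro integral_has_vector_derivative) (auto intro: continuous_on_subset)
      from continuous_add[OF continuous_const has_vector_derivative_continuous[OF this]]
      have "continuous (at t within {0..t + 1}) (Y (Suc j))"
        unfolding Y_Suc step_def .
      moreover have "at t within {0..} = at t within {0..t + 1}"
        using t by (intro at_within_nhd[of _ "{..<t + 1}"]) auto
      ultimately show "continuous (at t within {0..}) (Y (Suc j))"
        by simp
    qed
    moreover have "continuous_on {..0} (Y (Suc j))"
      by (rule continuous_on_eq[of _ "\<lambda>_. p"]) (auto simp: past)
    ultimately have "continuous_on ({0..} \<union> {..0}) (Y (Suc j))"
      by (intro continuous_on_closed_Un) auto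
    moreover have "{0..} \<union> {..0::real} = UNIV" by auto
    ultimately show ?case by simp
  qed (simp add: Y_def)
  \<comment> \<open>one more iteration changes nothing on the times that the delay has already reached\<close>
  have stable: "Y (Suc j) t = Y j t" if "t \<le> j * h" for j t
    using that
  proof (induction j arbitrary: t)
    case 0
    then show ?case by (simp add: past)
  next
    case (Suc j)
    have "integral {0..t} (\<lambda>s. G (Y (Suc j) (s - h))) = integral {0..t} (\<lambda>s. G (Y j (s - h)))"
    proof (rule integral_cong)
      fix s assume "s \<in> {0..t}"
      then have "s - h \<le> j * h" using Suc.prems by (auto simp: algebra_simps)
      then show "G (Y (Suc j) (s - h)) = G (Y j (s - h))" using Suc.IH by simp
    qed
    then show ?case
      unfolding Y_Suc[of "Suc j"] Y_Suc[of j] step_def by simp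
  qed
  obtain j :: nat where j: "b \<le> j * h"
    using reals_Archimedean3[OF h] by (meson less_imp_le)
  have "Y j t = p + integral {0..t} (\<lambda>s. G (Y j (s - h)))" if "t \<in> {0..b}" for t
    using stable[of t j] that j unfolding Y_Suc step_def by auto
  then show ?thesis
    by (intro exI[of _ "Y j"] conjI allI ballI impI cont past)
qed

text \<open>
  The solutions with delay \<open>1 / (n + 1)\<close> share the Lipschitz constant \<open>B\<close>, so a
  subsequence converges uniformly by Arzela-Ascoli, and the delay disappears in the limit of the
  integral equations.
\<close>

lemma Peano_existence:
  fixes G :: "'a::euclidean_space \<Rightarrow> 'a"
  assumes G: "continuous_on UNIV G" and B: "\<And>x. norm (G x) \<le> B" and b: "0 \<le> b"
  obtains y where "solution_on G y {0..b}" "y 0 = p"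
proof -
  define h where "h n = inverse (real (Suc n))" for n
  have h: "h n > 0" for n by (simp add: h_def)
  have "\<exists>y. \<forall>n. continuous_on UNIV (y n) \<and> (\<forall>t\<le>0. y n t = p)
      \<and> (\<forall>t\<in>{0..b}. y n t = p + integral {0..t} (\<lambda>s. G (y n (s - h n))))"
    by (intro choice allI delayed_solution_exists G h)
  then obtain y where Y: "\<forall>n. continuous_on UNIV (y n) \<and> (\<forall>t\<le>0. y n t = p)
      \<and> (\<forall>t\<in>{0..b}. y n t = p + integral {0..t} (\<lambda>s. G (y n (s - h n))))" ..
  have y: "continuous_on UNIV (y n)" "t \<le> 0 \<Longrightarrow> y n t = p"
      "t \<in> {0..b} \<Longrightarrow> y n t = p + integral {0..t} (\<lambda>s. G (y n (s - h n)))" for n t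
    using Y by blast+
  have B0: "B \<ge> 0" using B[of p] norm_ge_zero order_trans by blast
  have contG: "continuous_on S (\<lambda>s. G (y n (s - h n)))" for n S
    by (intro continuous_on_compose2[OF G, of _ "\<lambda>s. y n (s - h n)"]
        continuous_on_compose2[OF y(1), of _ "\<lambda>s. s - h n"] continuous_intros subset_UNIV)
  have lip0: "norm (y n t - y n s) \<le> B * (t - s)" if st: "0 \<le> s" "s \<le> t" "t \<le> b" for n s t
  proof -
    have "integral {0..s} (\<lambda>s. G (y n (s - h n))) + integral {s..t} (\<lambda>s. G (y n (s - h n)))
        = integral {0..t} (\<lambda>s. G (y n (s - h n)))"
      using st contG by (intro Henstock_Kurzweil_Integration.integral_combine integrable_continuous_real) auto
    then have "y n t - y n s = integral {s..t} (\<lambda>s. G (y n (s - h n)))"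
      using st y(3)[of t n] y(3)[of s n] by (simp add: algebra_simps)
    then show ?thesis
      using integral_bound[OF st(2) contG, of n B] B by simp
  qed
  have lip: "norm (y n t - y n s) \<le> B * \<bar>t - s\<bar>" if "s \<in> {0..b}" "t \<in> {0..b}" for n s t
    using lip0[of s t n] lip0[of t s n] that by (cases "s \<le> t") (auto simp: norm_minus_commute)
  have bound: "norm (y n t) \<le> norm p + B * b" if "t \<in> {0..b}" for n t
  proof -
    have "norm (y n t - p) \<le> B * b"
      using lip0[of 0 t n] that y(2)[of 0 n] mult_left_mono[of t b B] B0 by auto
    then show ?thesis
      using norm_triangle_sub[of "y n t" p] by linarith
  qed
  have equicont: "\<exists>d. 0 < d \<and> (\<forall>n t. t \<in> {0..b} \<and> norm (s - t) < d \<longrightarrow> norm (y n s - y n t) < e)"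
    if s: "s \<in> {0..b}" and e: "e > 0" for s e
  proof (intro exI conjI allI impI)
    show "0 < e / (B + 1)" using e B0 by simp
    fix n t assume t: "t \<in> {0..b} \<and> norm (s - t) < e / (B + 1)"
    have "norm (y n s - y n t) \<le> B * \<bar>s - t\<bar>" using lip s t by auto
    also have "\<dots> \<le> (B + 1) * \<bar>s - t\<bar>" by (intro mult_right_mono) auto
    also have "\<dots> < e" using t B0 by (simp add: field_simps)
    finally show "norm (y n s - y n t) < e" .
  qed
  have "\<exists>g k. continuous_on {0..b} g \<and> strict_mono (k :: nat \<Rightarrow> nat)
      \<and> (\<forall>e>0. \<exists>N. \<forall>n t. n \<ge> N \<and> t \<in> {0..b} \<longrightarrow> norm (y (k n) t - g t) < e)"
  proof (rule Arzela_Ascoli[OF compact_Icc, of 0 b y, OF bound equicont])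
    fix g and k :: "nat \<Rightarrow> nat" assume "continuous_on {0..b} g" "strict_mono k"
      and unif: "\<And>e. 0 < e \<Longrightarrow> \<exists>N. \<forall>n t. N \<le> n \<and> t \<in> {0..b} \<longrightarrow> norm (y (k n) t - g t) < e"
    moreover have "\<forall>e>0. \<exists>N. \<forall>n t. n \<ge> N \<and> t \<in> {0..b} \<longrightarrow> norm (y (k n) t - g t) < e"
      by (intro allI impI unif)
    ultimately show ?thesis by (intro exI[of _ g] exI[of _ k] conjI)
  qed
  then obtain g k where g: "continuous_on {0..b} g" and k: "strict_mono (k :: nat \<Rightarrow> nat)"
    and unif: "\<forall>e>0. \<exists>N. \<forall>n t. n \<ge> N \<and> t \<in> {0..b} \<longrightarrow> norm (y (k n) t - g t) < e"
    by (elim exE conjE) (rule that)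
  have lim: "(\<lambda>n. y (k n) t) \<longlonglongrightarrow> g t" if t: "t \<in> {0..b}" for t
  proof (rule LIMSEQ_I)
    fix e :: real assume "0 < e"
    with unif obtain N where "\<forall>n t. n \<ge> N \<and> t \<in> {0..b} \<longrightarrow> norm (y (k n) t - g t) < e"
      by blast
    then show "\<exists>N. \<forall>n\<ge>N. norm (y (k n) t - g t) < e"
      using t by blast
  qed
  have h0: "(\<lambda>n. h (k n)) \<longlonglongrightarrow> 0"
    using LIMSEQ_subseq_LIMSEQ[OF LIMSEQ_inverse_real_of_nat k] by (simp add: h_def o_def)
  \<comment> \<open>the approximations are uniformly Lipschitz, so the vanishing delay does not change the limit\<close>
  have delayed: "(\<lambda>n. y (k n) (s - h (k n))) \<longlonglongrightarrow> g s" if s: "s \<in> {0..b}" for s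
  proof -
    have "norm (y (k n) (s - h (k n)) - y (k n) s) \<le> B * h (k n)" for n
    proof (cases "s - h (k n) \<ge> 0")
      case True
      then show ?thesis
        using lip0[of "s - h (k n)" s "k n"] s h[of "k n"] by (simp add: norm_minus_commute)
    next
      case False
      then have "norm (y (k n) (s - h (k n)) - y (k n) s) \<le> B * s"
        using lip0[of 0 s "k n"] s y(2)[of 0 "k n"] y(2)[of "s - h (k n)" "k n"]
        by (simp add: norm_minus_commute)
      also have "\<dots> \<le> B * h (k n)" using False B0 by (intro mult_left_mono) auto
      finally show ?thesis .
    qed
    moreover have "(\<lambda>n. B * h (k n)) \<longlonglongrightarrow> 0"
      using tendsto_mult[OF tendsto_const h0, of B] by simp
    ultimately have "(\<lambda>n. y (k n) (s - h (k n)) - y (k n) s) \<longlonglongrightarrow> 0"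
      by (rule Lim_null_comparison[OF always_eventually[OF allI]])
    from tendsto_add[OF this lim[OF s]] show ?thesis by simp
  qed
  have integral_eq: "g t = p + integral {0..t} (\<lambda>s. G (g s))" if t: "t \<in> {0..b}" for t
  proof (rule LIMSEQ_unique[OF lim[OF t]])
    have "(\<lambda>n. integral {0..t} (\<lambda>s. G (y (k n) (s - h (k n))))) \<longlonglongrightarrow> integral {0..t} (\<lambda>s. G (g s))"
    proof (rule dominated_convergence(2)[where h = "\<lambda>_. B"])
      show "(\<lambda>n. G (y (k n) (s - h (k n)))) \<longlonglongrightarrow> G (g s)" if "s \<in> {0..t}" for s
      proof -
        have "isCont G (g s)" using G by (simp add: continuous_on_eq_continuous_at)
        then show ?thesis
          by (rule isCont_tendsto_compose) (use delayed that t in simp)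
      qed
      show "(\<lambda>s. G (y (k n) (s - h (k n)))) integrable_on {0..t}" for n
        by (rule integrable_continuous_real[OF contG])
      show "(\<lambda>_. B) integrable_on {0..t}"
        by (rule integrable_continuous_real[OF continuous_on_const])
    qed (rule B)
    from tendsto_add[OF tendsto_const this, of p]
    show "(\<lambda>n. y (k n) t) \<longlonglongrightarrow> p + integral {0..t} (\<lambda>s. G (g s))"
      using y(3)[OF t] by simp
  qed
  have "solution_on G g {0..b}"
    unfolding solution_on_def
  proof
    fix t assume t: "t \<in> {0..b}"
    have "((\<lambda>u. integral {0..u} (\<lambda>s. G (g s))) has_vector_derivative G (g t)) (at t within {0..b})"
      by (rule integral_has_vector_derivative[OF continuous_on_compose2[OF G g subset_UNIV] t])
    from has_vector_derivative_add[OF has_vector_derivative_const this]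
    have deriv: "((\<lambda>u. p + integral {0..u} (\<lambda>s. G (g s))) has_vector_derivative G (g t)) (at t within {0..b})"
      by simp
    show "(g has_vector_derivative G (g t)) (at t within {0..b})"
      by (rule has_vector_derivative_transform[OF t _ deriv], rule integral_eq)
  qed
  moreover have "g 0 = p"
    using integral_eq[of 0] b by (metis add.right_neutral atLeastAtMost_iff integral_singleton atLeastAtMost_singleton order_refl)
  ultimately show thesis
    by (rule that)
qed

text \<open>
  If \<open>v\<close> exceeded \<open>c\<close>, then at the last earlier time with \<open>v \<le> c\<close> it would equal \<open>c\<close> and be
  about to decrease.
\<close>

lemma barrier_stays_below:
  fixes v :: "real \<Rightarrow> real"
  assumes deriv: "\<And>t. t \<in> {0..b} \<Longrightarrow> (v has_real_derivative v' t) (at t within {0..b})"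
    and start: "v 0 \<le> c"
    and barrier: "\<And>t. t \<in> {0..b} \<Longrightarrow> v t = c \<Longrightarrow> v' t < 0"
    and t: "t \<in> {0..b}"
  shows "v t \<le> c"
proof (rule ccontr)
  assume "\<not> v t \<le> c"
  define S where "S = {s \<in> {0..t}. v s \<le> c}"
  have cont: "continuous_on {0..t} v"
    using t by (intro continuous_on_subset[OF DERIV_continuous_on[OF deriv]]) auto
  have "closed S"
    unfolding S_def using continuous_closed_preimage[OF cont, of "{..c}"]
    by (simp add: vimage_def Int_def)
  moreover have "bounded S" unfolding S_def by (rule bounded_subset[of "{0..t}"]) auto
  moreover have "S \<noteq> {}" using start t by (auto simp: S_def)
  ultimately obtain s where s: "s \<in> S" "\<And>u. u \<in> S \<Longrightarrow> u \<le> s"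
    using compact_attains_sup[of S] by (auto simp: compact_eq_bounded_closed)
  have st: "0 \<le> s" "s < t" "v s \<le> c"
    using s(1) \<open>\<not> v t \<le> c\<close> by (auto simp: S_def less_le)
  have above: "v u > c" if "u \<in> {s<..t}" for u
    using that s(2)[of u] st by (force simp: S_def)
  have "v s = c"
  proof (rule ccontr)
    assume "v s \<noteq> c"
    then have "\<exists>u. s \<le> u \<and> u \<le> t \<and> v u = c"
      using st \<open>\<not> v t \<le> c\<close> by (intro IVT') (auto intro: continuous_on_subset[OF cont])
    then show False using above \<open>v s \<noteq> c\<close> by (force simp: less_le)
  qed
  then have "v' s < 0" using barrier st t by auto
  then obtain d where d: "d > 0" "\<And>h. 0 < h \<Longrightarrow> s + h \<in> {0..b} \<Longrightarrow> h < d \<Longrightarrow> v (s + h) < v s"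
    using has_real_derivative_neg_dec_right[OF deriv[of s]] st t by auto
  define h where "h = min (d / 2) (t - s)"
  have "0 < h" "h < d" "s + h \<in> {s<..t}"
    using d(1) st by (auto simp: h_def min_def)
  then show False
    using d(2)[of h] above[of "s + h"] st t \<open>v s = c\<close> by auto
qed

section \<open>Orthonormal moving frames\<close>

lemma transpose_mult_eq_sum:
  fixes A :: "real^'n^'m"
  shows "transpose A *v x = (\<Sum>k\<in>UNIV. (x $ k) *\<^sub>R A $ k)"
  by (simp add: vec_eq_iff matrix_vector_mult_def transpose_def mult.commute)

lemma bounded_bilinear_transpose_mult:
  "bounded_bilinear (\<lambda>A x. transpose (A :: real^'n^'m) *v x)"
proof -
  have "bilinear (\<lambda>A x. transpose (A :: real^'n^'m) *v x)"
    unfolding bilinear_def linear_iff transpose_mult_eq_sum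
    by (simp add: algebra_simps sum.distrib scaleR_right.sum)
  then show ?thesis
    by (simp add: bilinear_conv_bounded_bilinear)
qed

lemma bounded_bilinear_matrix_vector_mult:
  "bounded_bilinear (\<lambda>A x. (A :: real^'n^'m) *v x)"
proof -
  have "bilinear (\<lambda>A x. (A :: real^'n^'m) *v x)"
    unfolding bilinear_def linear_iff
    by (simp add: matrix_vector_mult_add_rdistrib matrix_vector_right_distrib
        matrix_vector_mult_scaleR scaleR_matrix_vector_assoc)
  then show ?thesis
    by (simp add: bilinear_conv_bounded_bilinear)
qed

lemma orthonormal_rows_right_inverse:
  fixes A :: "real^'n^'m"
  assumes "\<And>k l. A $ k \<bullet> A $ l = (if k = l then 1 else 0)"
  shows "A *v (transpose A *v x) = x"
  unfolding transpose_mult_eq_sum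
  by (simp add: vec_eq_iff matrix_vector_mul_component inner_sum_right assms if_distrib cong: if_cong)

lemma orthogonal_rows_annihilate:
  fixes A :: "real^'n^'m"
  assumes "\<And>k. u \<bullet> A $ k = 0"
  shows "u \<bullet> (transpose A *v x) = 0"
  unfolding transpose_mult_eq_sum by (simp add: inner_sum_right assms)

text \<open>
  The rows of \<open>A\<close> and the unit vector \<open>u\<close> are together as many orthonormal vectors as the dimension
  allows. The defect between the two sides is orthogonal to all of them, so it must vanish.
\<close>

lemma orthonormal_rows_projection:
  fixes A :: "real^'n^'m"
  assumes card: "CARD('n) = Suc (CARD('m))"
    and rows: "\<And>k l. A $ k \<bullet> A $ l = (if k = l then 1 else 0)"
    and u: "norm u = 1" "\<And>k. u \<bullet> A $ k = 0"
  shows "transpose A *v (A *v v) = v - (u \<bullet> v) *\<^sub>R u"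
proof (rule ccontr)
  define w where "w = v - (u \<bullet> v) *\<^sub>R u - transpose A *v (A *v v)"
  assume "\<not> ?thesis"
  then have w: "w \<noteq> 0" by (auto simp: w_def)
  have uu: "u \<bullet> u = 1" using u(1) by (simp add: dot_square_norm)
  have wu: "u \<bullet> w = 0"
    using orthogonal_rows_annihilate[of u A, OF u(2)]
    by (simp add: w_def inner_diff_right uu)
  have wA: "A $ k \<bullet> w = 0" for k
  proof -
    have "A $ k \<bullet> (transpose A *v (A *v v)) = A $ k \<bullet> v"
      unfolding matrix_vector_mul_component[symmetric] orthonormal_rows_right_inverse[OF rows] ..
    then show ?thesis
      using u(2)[of k] by (simp add: w_def inner_diff_right inner_commute)
  qed
  have "A $ k \<noteq> 0" for k
    using rows[of k k] by force
  then have nz: "u \<noteq> 0" "\<And>k. A $ k \<noteq> 0"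
    using u(1) by auto
  \<comment> \<open>one orthogonal nonzero vector too many\<close>
  let ?B = "insert w (insert u (range (($) A)))"
  have "pairwise orthogonal ?B"
    using wu wA u(2) rows
    by (auto simp: pairwise_def orthogonal_def inner_commute split: if_splits)
  moreover have "0 \<notin> ?B" using w nz by auto
  ultimately have "independent ?B" by (rule pairwise_orthogonal_independent)
  then have "card ?B \<le> CARD('n)"
    using independent_bound[of ?B] by simp
  moreover have "inj (($) A)"
    using rows by (intro injI) (metis zero_neq_one)
  then have "card (range (($) A)) = CARD('m)"
    by (simp add: card_image)
  moreover have "u \<notin> range (($) A)"
    using u(2) uu by force
  moreover have "w \<notin> insert u (range (($) A))"
  proof
    assume "w \<in> insert u (range (($) A))"
    then consider "w = u" | k where "w = A $ k" by auto
    then show False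
      using wu uu wA rows by cases (force, metis zero_neq_one)
  qed
  ultimately show False
    using card by simp
qed

text \<open>
  On the orthogonal complement of \<open>u\<close> the map \<open>h\<close> agrees with the reflection in the hyperplane
  orthogonal to \<open>u + z\<close>. That reflection is an isometry exchanging \<open>u\<close> and \<open>-z\<close>, so it
  carries this complement isometrically onto the complement of \<open>z\<close>.
\<close>

lemma householder_rows_orthonormal:
  fixes u z a b :: "'a::real_inner"
  assumes "norm u = 1" "norm z = 1" "1 + u \<bullet> z \<noteq> 0" "u \<bullet> a = 0" "u \<bullet> b = 0"
  defines "h \<equiv> \<lambda>v. v - ((v \<bullet> z) / (1 + u \<bullet> z)) *\<^sub>R (u + z)"
  shows "h a \<bullet> h b = a \<bullet> b" and "z \<bullet> h a = 0"
proof -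
  define c where "c = 1 + u \<bullet> z"
  have c: "c \<noteq> 0" using assms by (simp add: c_def)
  have uz: "u \<bullet> z = c - 1" "z \<bullet> u = c - 1" by (simp_all add: c_def inner_commute)
  have uu: "u \<bullet> u = 1" "z \<bullet> z = 1" using assms by (simp_all add: dot_square_norm)
  have au: "a \<bullet> u = 0" "b \<bullet> u = 0" using assms by (simp_all add: inner_commute)
  have ba: "b \<bullet> a = a \<bullet> b" "z \<bullet> a = a \<bullet> z" "z \<bullet> b = b \<bullet> z" by (simp_all add: inner_commute)
  show "h a \<bullet> h b = a \<bullet> b"
    unfolding h_def c_def[symmetric] using c
    by (simp add: inner_diff_left inner_diff_right inner_add_left inner_add_right uz uu au ba assms(4,5) field_simps)
  show "z \<bullet> h a = 0"
    unfolding h_def c_def[symmetric] using c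
    by (simp add: inner_diff_left inner_diff_right inner_add_left inner_add_right uz uu au ba assms(4,5) field_simps)
qed

text \<open>
  Unit vectors with inner product -1 are opposite, by the equality case of Cauchy-Schwarz.
\<close>

lemma not_collinear_inner_neq:
  fixes u v :: "'a::real_inner"
  assumes "norm u = 1" "norm v = 1" "\<not> collinear {0, u, v}"
  shows "1 + u \<bullet> v \<noteq> 0"
proof
  assume "1 + u \<bullet> v = 0"
  then have "\<bar>u \<bullet> v\<bar> = norm u * norm v" using assms by simp
  then show False using assms(3) norm_cauchy_schwarz_equal by metis
qed

text \<open>
  In the plane this is a rotation by a right angle; in higher dimension the rows are the
  reflections of \<open>\<eta>\<^sub>2, \<dots>, \<eta>\<^sub>n\<close> in the hyperplane orthogonal to \<open>\<eta>\<^sub>1 + z\<close>.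
\<close>

lemma projection_operator_orthonormal:
  fixes z :: "real \<Rightarrow> real^'n" and r :: "'m::finite \<Rightarrow> nat" and e :: "nat \<Rightarrow> 'n"
  assumes dim: "CARD('n) \<ge> 2"
    and coords: "bij_betw e {1..CARD('n)} UNIV"
    and rows: "bij_betw r UNIV {2..CARD('n)}"
    and z: "norm (z \<tau>) = 1"
    and basis: "CARD('n) \<ge> 3 \<Longrightarrow> orthonormal_basis \<eta>"
    and not_collinear: "CARD('n) \<ge> 3 \<Longrightarrow> \<not> collinear {0, \<eta> 1, z \<tau>}"
  defines "P \<equiv> projection_operator e r \<eta> z"
  shows "P \<tau> $ k \<bullet> P \<tau> $ l = (if k = l then 1 else 0)" and "z \<tau> \<bullet> P \<tau> $ k = 0"
proof -
  have row: "P \<tau> $ k = xi e \<eta> z (r k) \<tau>" for k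
    by (simp add: P_def projection_operator_def)
  have r: "r k \<in> {2..CARD('n)}" for k
    using rows by (auto simp: bij_betw_def)
  have r_inj: "r k = r l \<longleftrightarrow> k = l" for k l
    using rows by (auto simp: bij_betw_def inj_on_def)
  have "P \<tau> $ k \<bullet> P \<tau> $ l = (if k = l then 1 else 0) \<and> z \<tau> \<bullet> P \<tau> $ k = 0"
  proof (cases "CARD('n) = 2")
    case True
    have kl: "k = l"
      using r[of k] r[of l] r_inj True by (metis atLeastAtMost_iff le_antisym)
    have e: "UNIV = {e 1, e 2}" "e 1 \<noteq> e 2"
      using coords True by (auto simp: bij_betw_def inj_on_def numeral_2_eq_2 atLeastAtMostSuc_conv)
    have two: "v \<bullet> w = v $ e 1 * w $ e 1 + v $ e 2 * w $ e 2" for v w :: "real^'n"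
      using e(2) unfolding inner_vec_def e(1) by simp
    show ?thesis
      using z e(2) unfolding norm_eq_1 row kl xi_def
      by (simp add: True two algebra_simps)
  next
    case False
    then have n: "CARD('n) \<ge> 3" using dim by simp
    have \<eta>: "\<eta> i \<bullet> \<eta> j = (if i = j then 1 else 0)" if "i \<in> {1..CARD('n)}" "j \<in> {1..CARD('n)}" for i j
      using basis[OF n] that by (auto simp: orthonormal_basis_def)
    have \<eta>1: "norm (\<eta> 1) = 1"
      using \<eta>[of 1 1] n by (simp add: norm_eq_1)
    have c: "1 + \<eta> 1 \<bullet> z \<tau> \<noteq> 0"
      by (rule not_collinear_inner_neq[OF \<eta>1 z not_collinear[OF n]])
    have orth: "\<eta> 1 \<bullet> \<eta> (r k) = 0" for k
      using \<eta>[of 1 "r k"] r[of k] by auto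
    have "\<eta> (r k) \<bullet> \<eta> (r l) = (if k = l then 1 else 0)"
      using \<eta>[of "r k" "r l"] r[of k] r[of l] r_inj by auto
    then show ?thesis
      using householder_rows_orthonormal[OF \<eta>1 z c orth[of k] orth[of l]] False
      unfolding row xi_def by simp
  qed
  then show "P \<tau> $ k \<bullet> P \<tau> $ l = (if k = l then 1 else 0)" "z \<tau> \<bullet> P \<tau> $ k = 0"
    by auto
qed

lemma has_vector_derivative_vec:
  fixes A :: "real \<Rightarrow> ('a::euclidean_space)^'m"
  assumes "\<And>k. ((\<lambda>t. A t $ k) has_vector_derivative A' $ k) (at \<tau>)"
  shows "(A has_vector_derivative A') (at \<tau>)"
proof -
  have axis: "bounded_linear (axis k :: 'a \<Rightarrow> 'a^'m)" for k
    by (intro linear_conv_bounded_linear[THEN iffD1] linearI) (simp_all add: axis_def vec_eq_iff)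
  have sum: "(\<Sum>k\<in>UNIV. axis k (v $ k)) = v" for v :: "'a^'m"
    by (simp add: vec_eq_iff axis_def if_distrib cong: if_cong)
  have "((\<lambda>t. \<Sum>k\<in>UNIV. axis k (A t $ k)) has_vector_derivative (\<Sum>k\<in>UNIV. axis k (A' $ k))) (at \<tau>)"
    by (intro has_vector_derivative_sum bounded_linear.has_vector_derivative[OF axis] assms)
  then show ?thesis by (simp add: sum)
qed

lemma xi_C1:
  fixes z z' :: "real \<Rightarrow> real^'n"
  assumes z: "\<And>\<tau>. (z has_vector_derivative z' \<tau>) (at \<tau>)" and z': "continuous_on UNIV z'"
    and c: "CARD('n) \<noteq> 2 \<Longrightarrow> \<forall>\<tau>. 1 + \<eta> 1 \<bullet> z \<tau> \<noteq> 0"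
  shows "\<exists>\<xi>'. (\<forall>\<tau>. (xi e \<eta> z j has_vector_derivative \<xi>' \<tau>) (at \<tau>)) \<and> continuous_on UNIV \<xi>'"
proof (cases "CARD('n) = 2")
  case True
  have comp: "((\<lambda>\<tau>. z \<tau> $ i) has_vector_derivative z' \<tau> $ i) (at \<tau>)" for i \<tau>
    by (rule bounded_linear.has_vector_derivative[OF bounded_linear_vec_nth z])
  let ?\<xi>' = "\<lambda>\<tau>. (\<chi> i. if i = e 1 then - (z' \<tau> $ e 2) else z' \<tau> $ e 1) :: real^'n"
  have "(xi e \<eta> z j has_vector_derivative ?\<xi>' \<tau>) (at \<tau>)" for \<tau>
    by (rule has_vector_derivative_vec)
      (use True in \<open>auto simp: xi_def intro: has_vector_derivative_minus comp\<close>)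
  moreover have "continuous_on UNIV ?\<xi>'"
  proof (rule continuous_on_vec_lambda)
    show "continuous_on UNIV (\<lambda>\<tau>. if i = e 1 then - (z' \<tau> $ e 2) else z' \<tau> $ e 1)" for i
      by (cases "i = e 1") (simp_all add: continuous_on_minus continuous_on_component z')
  qed
  ultimately show ?thesis by (intro exI[of _ ?\<xi>'] conjI allI)
next
  case False
  let ?a = "\<lambda>\<tau>. (\<eta> j \<bullet> z \<tau>) / (1 + \<eta> 1 \<bullet> z \<tau>)"
  let ?a' = "\<lambda>\<tau>. ((\<eta> j \<bullet> z' \<tau>) * (1 + \<eta> 1 \<bullet> z \<tau>) - (\<eta> j \<bullet> z \<tau>) * (\<eta> 1 \<bullet> z' \<tau>))
      / ((1 + \<eta> 1 \<bullet> z \<tau>) * (1 + \<eta> 1 \<bullet> z \<tau>))"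
  let ?\<xi>' = "\<lambda>\<tau>. - (?a \<tau> *\<^sub>R z' \<tau> + ?a' \<tau> *\<^sub>R (\<eta> 1 + z \<tau>))"
  have inner: "((\<lambda>\<tau>. v \<bullet> z \<tau>) has_real_derivative v \<bullet> z' \<tau>) (at \<tau>)" for v \<tau>
    unfolding has_real_derivative_iff_has_vector_derivative
    by (rule bounded_linear.has_vector_derivative[OF bounded_linear_inner_right z])
  have "(?a has_real_derivative ?a' \<tau>) (at \<tau>)" for \<tau>
    using c False by (intro DERIV_divide inner) (auto intro!: derivative_eq_intros inner)
  then have "((\<lambda>\<tau>. ?a \<tau> *\<^sub>R (\<eta> 1 + z \<tau>)) has_vector_derivative
      (?a \<tau> *\<^sub>R (0 + z' \<tau>) + ?a' \<tau> *\<^sub>R (\<eta> 1 + z \<tau>))) (at \<tau>)" for \<tau>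
    by (intro has_vector_derivative_scaleR has_vector_derivative_add has_vector_derivative_const z)
  then have "((\<lambda>\<tau>. \<eta> j - ?a \<tau> *\<^sub>R (\<eta> 1 + z \<tau>)) has_vector_derivative
      (0 - (?a \<tau> *\<^sub>R (0 + z' \<tau>) + ?a' \<tau> *\<^sub>R (\<eta> 1 + z \<tau>)))) (at \<tau>)" for \<tau>
    by (intro has_vector_derivative_diff has_vector_derivative_const)
  then have "(xi e \<eta> z j has_vector_derivative ?\<xi>' \<tau>) (at \<tau>)" for \<tau>
    using False by (simp add: xi_def[abs_def])
  moreover have "continuous_on UNIV z"
    using z by (intro continuous_at_imp_continuous_on ballI has_vector_derivative_continuous)
  then have "continuous_on UNIV ?\<xi>'"
    using c False by (intro continuous_intros z') auto
  ultimately show ?thesis by (intro exI[of _ ?\<xi>'] conjI allI)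
qed

lemma projection_operator_C1:
  fixes z z' :: "real \<Rightarrow> real^'n" and r :: "'m::finite \<Rightarrow> nat"
  assumes z: "\<And>\<tau>. (z has_vector_derivative z' \<tau>) (at \<tau>)" and z': "continuous_on UNIV z'"
    and c: "CARD('n) \<noteq> 2 \<Longrightarrow> \<forall>\<tau>. 1 + \<eta> 1 \<bullet> z \<tau> \<noteq> 0"
  shows "\<exists>P'. (\<forall>\<tau>. (projection_operator e r \<eta> z has_vector_derivative P' \<tau>) (at \<tau>))
    \<and> continuous_on UNIV P'"
proof -
  have "\<exists>\<xi>'. \<forall>k. (\<forall>\<tau>. (xi e \<eta> z (r k) has_vector_derivative \<xi>' k \<tau>) (at \<tau>)) \<and> continuous_on UNIV (\<xi>' k)"
    by (intro choice allI xi_C1[of z z' \<eta>, OF z z' c])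
  then obtain \<xi>' where \<xi>': "\<And>k \<tau>. (xi e \<eta> z (r k) has_vector_derivative \<xi>' k \<tau>) (at \<tau>)"
      "\<And>k. continuous_on UNIV (\<xi>' k)"
    by blast
  let ?P' = "\<lambda>\<tau>. \<chi> k. \<xi>' k \<tau>"
  have "(projection_operator e r \<eta> z has_vector_derivative ?P' \<tau>) (at \<tau>)" for \<tau>
    by (rule has_vector_derivative_vec) (simp add: projection_operator_def \<xi>'(1))
  moreover have "continuous_on UNIV ?P'"
    by (rule continuous_on_vec_lambda) (rule \<xi>'(2))
  ultimately show ?thesis by (intro exI[of _ ?P'] conjI allI)
qed

lemma projection_operator_periodic:
  assumes "periodic T z"
  shows "periodic T (projection_operator e r \<eta> z)"
  unfolding periodic_def
proof
  fix t
  have "z (t + T) = z t" using assms by (simp add: periodic_def)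
  then show "projection_operator e r \<eta> z (t + T) = projection_operator e r \<eta> z t"
    by (simp add: projection_operator_def xi_def cong: if_cong)
qed

section \<open>The chart of transverse coordinates\<close>

lemma periodic_int:
  assumes "periodic T g"
  shows "g (t + of_int k * T) = g t"
proof -
  have nat: "g (t + real n * T) = g t" for n t
  proof (induction n)
    case (Suc n)
    have "g (t + real (Suc n) * T) = g ((t + real n * T) + T)" by (simp add: algebra_simps)
    also have "\<dots> = g t" using assms Suc by (simp add: periodic_def)
    finally show ?case .
  qed simp
  show ?thesis
  proof (cases "k \<ge> 0")
    case True
    then show ?thesis using nat[of t "nat k"] by simp
  next
    case False
    then show ?thesis using nat[of "t + of_int k * T" "nat (- k)"] by simp
  qed
qed

lemma shift_into_period:
  assumes "(T :: real) > 0"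
  obtains k :: int where "t + of_int k * T \<in> {0..<T}"
proof
  show "t + of_int (- \<lfloor>t / T\<rfloor>) * T \<in> {0..<T}"
    using floor_divide_lower[OF assms, of t] floor_divide_upper[OF assms, of t]
    by (simp add: algebra_simps)
qed

lemma periodic_derivative:
  assumes g: "periodic T g" and deriv: "\<And>t. (g has_vector_derivative g' t) (at t)"
  shows "periodic T g'"
  unfolding periodic_def
proof
  fix t
  have "((\<lambda>s. s + T) has_vector_derivative 1) (at t)"
    by (auto intro!: derivative_eq_intros)
  from vector_diff_chain_at[OF this deriv]
  have "((\<lambda>s. g (s + T)) has_vector_derivative g' (t + T)) (at t)"
    by (simp add: o_def)
  moreover have "(\<lambda>s. g (s + T)) = g" using g by (auto simp: periodic_def)
  ultimately show "g' (t + T) = g' t"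
    using vector_derivative_unique_at deriv[of t] by fastforce
qed

text \<open>
  A moving orthonormal frame along a periodic solution: the unit field \<open>z\<close> and the rows of \<open>P\<close> span
  the space at each \<open>\<tau>\<close>. The computation of the transverse dynamics rests on these relations and
  on one continuous derivative of the frame.
\<close>

locale transverse_frame =
  fixes f :: "real^'n \<Rightarrow> real^'n" and xs z z' :: "real \<Rightarrow> real^'n"
    and P P' :: "real \<Rightarrow> real^'n^'m" and T :: real
  assumes f_cont: "continuous_on UNIV f"
    and xs_deriv: "(xs has_vector_derivative f (xs \<tau>)) (at \<tau>)"
    and z_deriv: "(z has_vector_derivative z' \<tau>) (at \<tau>)"
    and z'_cont: "continuous_on UNIV z'"
    and P_deriv: "(P has_vector_derivative P' \<tau>) (at \<tau>)"
    and P'_cont: "continuous_on UNIV P'"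
    and T_pos: "T > 0"
    and xs_periodic: "periodic T xs" and z_periodic: "periodic T z" and P_periodic: "periodic T P"
    and card: "CARD('n) = Suc (CARD('m))"
    and rows: "P \<tau> $ k \<bullet> P \<tau> $ l = (if k = l then 1 else 0)"
    and z_norm: "norm (z \<tau>) = 1"
    and z_rows: "z \<tau> \<bullet> P \<tau> $ k = 0"
begin

definition chart :: "(real^'m) \<times> real \<Rightarrow> real^'n" where
  "chart p = transverse_point xs P (fst p) (snd p)"

definition denom :: "(real^'m) \<times> real \<Rightarrow> real" where
  "denom p = transverse_denominator f xs z P (fst p) (snd p)"

definition transverse_field :: "(real^'m) \<times> real \<Rightarrow> (real^'m) \<times> real" where
  "transverse_field p = (perp_dot f xs z P (fst p) (snd p), tau_dot f xs z P (fst p) (snd p))"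

text \<open>
  The velocity of the chart at fixed \<open>x\<close> when \<open>\<tau>\<close> moves at unit speed.
\<close>

definition drift :: "(real^'m) \<times> real \<Rightarrow> real^'n" where
  "drift p = f (xs (snd p)) + transpose (P' (snd p)) *v fst p"

definition chart_deriv :: "(real^'m) \<times> real \<Rightarrow> (real^'m) \<times> real \<Rightarrow> real^'n" where
  "chart_deriv p q = snd q *\<^sub>R drift p + transpose (P (snd p)) *v fst q"

text \<open>
  The inverse of the derivative of the chart: the component of \<open>v\<close> along \<open>z\<close> fixes the speed of \<open>\<tau>\<close>,
  and \<open>P\<close> reads off the rest.
\<close>

definition chart_inv :: "(real^'m) \<times> real \<Rightarrow> real^'n \<Rightarrow> (real^'m) \<times> real" where
  "chart_inv p v = (let w = (z (snd p) \<bullet> v) / denom p in (P (snd p) *v (v - w *\<^sub>R drift p), w))"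

lemma vector_derivative_z: "vector_derivative z (at \<tau>) = z' \<tau>"
  by (rule vector_derivative_at) (rule z_deriv)

lemma vector_derivative_P: "vector_derivative P (at \<tau>) = P' \<tau>"
  by (rule vector_derivative_at) (rule P_deriv)

lemma has_vector_derivative_transpose_mult:
  "((\<lambda>\<tau>. transpose (P \<tau>) *v x) has_vector_derivative transpose (P' \<tau>) *v x) (at \<tau>)"
  using bounded_bilinear.has_vector_derivative[OF bounded_bilinear_transpose_mult P_deriv has_vector_derivative_const]
  by simp

text \<open>
  Differentiate the constant \<open>P P\<^sup>T x = x\<close>.
\<close>

lemma P_P'_skew: "P' \<tau> *v (transpose (P \<tau>) *v x) = - (P \<tau> *v (transpose (P' \<tau>) *v x))"
proof -
  have "((\<lambda>\<tau>. P \<tau> *v (transpose (P \<tau>) *v x)) has_vector_derivative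
      P \<tau> *v (transpose (P' \<tau>) *v x) + P' \<tau> *v (transpose (P \<tau>) *v x)) (at \<tau>)"
    by (rule bounded_bilinear.has_vector_derivative[OF bounded_bilinear_matrix_vector_mult
          P_deriv has_vector_derivative_transpose_mult])
  then have "((\<lambda>_. x) has_vector_derivative
      P \<tau> *v (transpose (P' \<tau>) *v x) + P' \<tau> *v (transpose (P \<tau>) *v x)) (at \<tau>)"
    by (simp only: orthonormal_rows_right_inverse[OF rows])
  then have "P \<tau> *v (transpose (P' \<tau>) *v x) + P' \<tau> *v (transpose (P \<tau>) *v x) = 0"
    by (rule vector_derivative_unique_at) (rule has_vector_derivative_const)
  then show ?thesis by (simp add: add_eq_0_iff)
qed

text \<open>
  Differentiate \<open>z \<bullet> P\<^sup>T x = 0\<close>.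
\<close>

lemma z_P'_skew: "z \<tau> \<bullet> (transpose (P' \<tau>) *v x) = - (z' \<tau> \<bullet> (transpose (P \<tau>) *v x))"
proof -
  have "((\<lambda>\<tau>. z \<tau> \<bullet> (transpose (P \<tau>) *v x)) has_vector_derivative
      z \<tau> \<bullet> (transpose (P' \<tau>) *v x) + z' \<tau> \<bullet> (transpose (P \<tau>) *v x)) (at \<tau>)"
    by (rule bounded_bilinear.has_vector_derivative[OF bounded_bilinear_inner
          z_deriv has_vector_derivative_transpose_mult])
  then have "((\<lambda>_. 0) has_vector_derivative
      z \<tau> \<bullet> (transpose (P' \<tau>) *v x) + z' \<tau> \<bullet> (transpose (P \<tau>) *v x)) (at \<tau>)"
    by (simp only: orthogonal_rows_annihilate[OF z_rows])
  then have "z \<tau> \<bullet> (transpose (P' \<tau>) *v x) + z' \<tau> \<bullet> (transpose (P \<tau>) *v x) = 0"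
    by (rule vector_derivative_unique_at) (rule has_vector_derivative_const)
  then show ?thesis by simp
qed

text \<open>
  This identifies the denominator of \<open>\<tau>'\<close>: it is the component along \<open>z\<close> of the velocity with which
  the chart moves when \<open>\<tau>\<close> runs at unit speed, hence nonzero exactly where the chart is regular.
\<close>

lemma z_drift: "z (snd p) \<bullet> drift p = denom p"
  by (simp add: drift_def denom_def transverse_denominator_def vector_derivative_z inner_add_right z_P'_skew
      del: transpose_matrix_vector)

lemma chart_deriv_chart_inv:
  assumes "denom p \<noteq> 0"
  shows "chart_deriv p (chart_inv p v) = v"
proof -
  define w where "w = (z (snd p) \<bullet> v) / denom p"
  have "z (snd p) \<bullet> (v - w *\<^sub>R drift p) = 0"
    using assms by (simp add: inner_diff_right z_drift w_def)
  then show ?thesis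
    unfolding chart_deriv_def chart_inv_def Let_def fst_conv snd_conv w_def[symmetric]
    by (simp add: orthonormal_rows_projection[OF card rows z_norm z_rows] del: transpose_matrix_vector)
qed

text \<open>
  The displayed formulas of the transverse dynamics are the pull-back of \<open>f\<close> along the chart; the term
  with \<open>P'\<close> takes the form it has in the pull-back by \<open>P_P'_skew\<close>.
\<close>

lemma transverse_field_eq_chart_inv: "transverse_field p = chart_inv p (f (chart p))"
  unfolding transverse_field_def chart_inv_def perp_dot_def tau_dot_def vector_derivative_P P_P'_skew
    chart_def[symmetric] denom_def[symmetric] Let_def drift_def
  by (simp add: matrix_vector_mult_diff_distrib matrix_vector_right_distrib matrix_vector_mult_scaleR
      algebra_simps)

lemma chart_deriv_field: "denom p \<noteq> 0 \<Longrightarrow> chart_deriv p (transverse_field p) = f (chart p)"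
  by (simp add: transverse_field_eq_chart_inv chart_deriv_chart_inv)

lemma has_derivative_snd_compose:
  assumes "(g has_vector_derivative g') (at (snd p))"
  shows "((\<lambda>q. g (snd q)) has_derivative (\<lambda>q. snd q *\<^sub>R g')) (at p)"
  using has_derivative_compose[OF has_derivative_snd[OF has_derivative_ident], of g "\<lambda>w. w *\<^sub>R g'" p UNIV] assms
  by (simp add: has_vector_derivative_def)

lemma has_derivative_chart: "(chart has_derivative chart_deriv p) (at p)"
proof -
  have "((\<lambda>q. transpose (P (snd q)) *v fst q) has_derivative
      (\<lambda>q. transpose (P (snd p)) *v fst q + transpose (snd q *\<^sub>R P' (snd p)) *v fst p)) (at p)"
    by (intro bounded_bilinear.FDERIV[OF bounded_bilinear_transpose_mult]
        has_derivative_snd_compose[OF P_deriv] has_derivative_fst has_derivative_ident)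
  from has_derivative_add[OF has_derivative_snd_compose[OF xs_deriv] this]
  have "((\<lambda>q. xs (snd q) + transpose (P (snd q)) *v fst q) has_derivative
    (\<lambda>q. snd q *\<^sub>R f (xs (snd p)) + (transpose (P (snd p)) *v fst q + transpose (snd q *\<^sub>R P' (snd p)) *v fst p))) (at p)" .
  moreover have "(\<lambda>q. snd q *\<^sub>R f (xs (snd p)) + (transpose (P (snd p)) *v fst q + transpose (snd q *\<^sub>R P' (snd p)) *v fst p))
      = chart_deriv p"
    by (simp add: chart_deriv_def[abs_def] drift_def algebra_simps
        bounded_bilinear.scaleR_left[OF bounded_bilinear_transpose_mult] del: transpose_matrix_vector)
  ultimately show ?thesis
    by (simp add: chart_def[abs_def] transverse_point_def)
qed

text \<open>
  The derivative has a right inverse there, which is enough for local openness.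
\<close>

lemma chart_interior:
  assumes "denom p \<noteq> 0" "p \<in> interior S"
  shows "chart p \<in> interior (chart ` S)"
proof (rule sussmann_open_mapping[OF open_UNIV _ UNIV_I has_derivative_chart])
  show "continuous_on UNIV chart"
    using has_derivative_chart by (blast intro: continuous_at_imp_continuous_on has_derivative_continuous)
  show "chart_deriv p \<circ> chart_inv p = id"
    using chart_deriv_chart_inv[OF assms(1)] by auto
  have "linear (chart_inv p)"
    by (rule linearI)
      (simp_all add: chart_inv_def Let_def inner_add_right matrix_vector_right_distrib
        matrix_vector_mult_diff_distrib matrix_vector_mult_scaleR add_divide_distrib algebra_simps)
  then show "bounded_linear (chart_inv p)"
    by (simp add: linear_conv_bounded_linear)
qed (use assms in auto)

lemma continuous_on_frame [continuous_intros]: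
  "continuous_on S xs" "continuous_on S z" "continuous_on S P"
  using xs_deriv z_deriv P_deriv
  by (blast intro: continuous_at_imp_continuous_on has_vector_derivative_continuous)+

lemma continuous_on_denom: "continuous_on UNIV denom"
proof -
  have "continuous_on UNIV (\<lambda>p. z (snd p) \<bullet> f (xs (snd p)) - z' (snd p) \<bullet> (transpose (P (snd p)) *v fst p))"
    by (intro continuous_intros
        continuous_on_compose2[OF f_cont] continuous_on_compose2[OF z'_cont]
        continuous_on_compose2[OF continuous_on_frame(1)[of UNIV]]
        continuous_on_compose2[OF continuous_on_frame(2)[of UNIV]]
        continuous_on_compose2[OF continuous_on_frame(3)[of UNIV]]
        bounded_bilinear.continuous_on[OF bounded_bilinear_transpose_mult]) simp_all
  then show ?thesis
    by (simp add: denom_def[abs_def] transverse_denominator_def vector_derivative_z)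
qed

lemma continuous_on_chart: "continuous_on UNIV chart"
  using has_derivative_chart by (blast intro: continuous_at_imp_continuous_on has_derivative_continuous)

lemma continuous_on_transverse_field: "continuous_on {p. denom p \<noteq> 0} transverse_field"
proof -
  let ?D = "{p. denom p \<noteq> 0}"
  have chart: "continuous_on ?D (\<lambda>p. f (chart p))"
    by (rule continuous_on_compose2[OF f_cont continuous_on_subset[OF continuous_on_chart]]) auto
  have den: "continuous_on ?D denom"
    by (rule continuous_on_subset[OF continuous_on_denom]) simp
  have zs: "continuous_on ?D (\<lambda>p. z (snd p))" and xss: "continuous_on ?D (\<lambda>p. xs (snd p))"
    and Ps: "continuous_on ?D (\<lambda>p. P (snd p))" and P's: "continuous_on ?D (\<lambda>p. P' (snd p))"
    by (rule continuous_on_compose2[OF _ continuous_on_snd[OF continuous_on_id] subset_UNIV],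
        rule continuous_on_frame P'_cont)+
  have fxs: "continuous_on ?D (\<lambda>p. f (xs (snd p)))"
    by (rule continuous_on_compose2[OF f_cont xss subset_UNIV])
  have drift: "continuous_on ?D drift"
    unfolding drift_def[abs_def]
    by (intro continuous_on_add fxs bounded_bilinear.continuous_on[OF bounded_bilinear_transpose_mult]
        P's continuous_on_fst continuous_on_id)
  have w: "continuous_on ?D (\<lambda>p. (z (snd p) \<bullet> f (chart p)) / denom p)"
    by (intro continuous_on_divide continuous_on_inner zs chart den) simp
  show ?thesis
    unfolding transverse_field_eq_chart_inv[abs_def] chart_inv_def Let_def
    by (intro continuous_on_Pair bounded_bilinear.continuous_on[OF bounded_bilinear_matrix_vector_mult]
        Ps continuous_on_diff continuous_on_scaleR chart drift w)
qed

lemma frame_shift: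
  "xs (\<tau> + of_int k * T) = xs \<tau>" "z (\<tau> + of_int k * T) = z \<tau>" "P (\<tau> + of_int k * T) = P \<tau>"
  "z' (\<tau> + of_int k * T) = z' \<tau>" "P' (\<tau> + of_int k * T) = P' \<tau>"
  using xs_periodic z_periodic P_periodic periodic_derivative[OF z_periodic z_deriv]
    periodic_derivative[OF P_periodic P_deriv]
  by (blast intro: periodic_int)+

lemma transverse_field_shift: "transverse_field (x, \<tau> + of_int k * T) = transverse_field (x, \<tau>)"
  by (simp add: transverse_field_def perp_dot_def tau_dot_def transverse_denominator_def transverse_point_def
      vector_derivative_z vector_derivative_P frame_shift)

end

section \<open>Lyapunov functions in transverse coordinates\<close>

text \<open>
  The periodic function \<open>V\<close> lives on the universal cover, where the coordinate \<open>\<tau>\<close> is a real number;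
  compactness of the unit sublevel set on the circle becomes boundedness in the \<open>x\<close> direction.
\<close>

locale transverse_lyapunov = transverse_frame f xs z z' P P' T
  for f :: "real^'n \<Rightarrow> real^'n" and xs z z' :: "real \<Rightarrow> real^'n"
    and P P' :: "real \<Rightarrow> real^'n^'m" and T :: real +
  fixes V :: "(real^'m) \<times> real \<Rightarrow> real" and V' :: "(real^'m) \<times> real \<Rightarrow> (real^'m) \<times> real \<Rightarrow> real"
  assumes f_C1: "Ck 1 f"
    and V_deriv: "(V has_derivative V' p) (at p)"
    and V'_cont: "continuous_on UNIV (\<lambda>p. V' p v)"
    and V_periodic: "periodic T (\<lambda>\<tau>. V (x, \<tau>))"
    and sublevel_bounded: "\<exists>B. \<forall>p. V p \<le> 1 \<longrightarrow> norm (fst p) \<le> B"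
    and V_pos: "V p \<le> 1 \<Longrightarrow> fst p \<noteq> 0 \<Longrightarrow> V p > 0"
    and V_zero: "V (0, \<tau>) = 0"
    and V_decr: "V p \<le> 1 \<Longrightarrow> fst p \<noteq> 0 \<Longrightarrow> V' p (transverse_field p) < 0"
    and V_stationary: "V' (0, \<tau>) (transverse_field (0, \<tau>)) = 0"
    and denom_pos: "V p \<le> 1 \<Longrightarrow> denom p > 0"
begin

definition sublevel :: "((real^'m) \<times> real) set" where
  "sublevel = {p. V p \<le> 1}"

definition rate :: "(real^'m) \<times> real \<Rightarrow> real" where
  "rate p = V' p (transverse_field p)"

lemma continuous_on_V: "continuous_on S V"
  using V_deriv by (blast intro: continuous_at_imp_continuous_on has_derivative_continuous)

lemma closed_sublevel: "closed sublevel"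
  unfolding sublevel_def by (intro closed_Collect_le continuous_on_V continuous_on_const)

lemma continuous_on_transverse_field_sublevel: "continuous_on sublevel transverse_field"
  using denom_pos by (intro continuous_on_subset[OF continuous_on_transverse_field]) (auto simp: sublevel_def less_le)

text \<open>
  Only \<open>p \<mapsto> V' p v\<close> for fixed \<open>v\<close> is known to be continuous, so the field is expanded in a
  basis.
\<close>

lemma continuous_on_rate: "continuous_on sublevel rate"
proof -
  have "rate p = (\<Sum>b\<in>Basis. (transverse_field p \<bullet> b) * V' p b)" for p
  proof -
    have "rate p = V' p (\<Sum>b\<in>Basis. (transverse_field p \<bullet> b) *\<^sub>R b)"
      by (simp add: rate_def euclidean_representation)
    also have "\<dots> = (\<Sum>b\<in>Basis. (transverse_field p \<bullet> b) * V' p b)"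
      using has_derivative_linear[OF V_deriv] by (simp add: linear_sum linear_scale)
    finally show ?thesis .
  qed
  moreover have "continuous_on sublevel (\<lambda>p. \<Sum>b\<in>Basis. (transverse_field p \<bullet> b) * V' p b)"
    by (intro continuous_on_sum continuous_on_mult continuous_on_inner continuous_on_transverse_field_sublevel
        continuous_on_const continuous_on_subset[OF V'_cont] subset_UNIV)
  ultimately show ?thesis by presburger
qed

lemma V_shift: "V (x, \<tau> + of_int k * T) = V (x, \<tau>)"
  by (rule periodic_int[OF V_periodic])

text \<open>
  \<open>V\<close> is invariant under the translation by a multiple of the period, so its derivative is too.
\<close>

lemma rate_shift: "rate (x, \<tau> + of_int k * T) = rate (x, \<tau>)"
proof -
  let ?c = "(0, of_int k * T) :: (real^'m) \<times> real"
  have "((\<lambda>p. V (p + ?c)) has_derivative V' ((x, \<tau>) + ?c)) (at (x, \<tau>))"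
  proof -
    have "((\<lambda>p. p + ?c) has_derivative (\<lambda>v. v)) (at (x, \<tau>))"
      by (auto intro!: derivative_eq_intros)
    from diff_chain_at[OF this V_deriv] show ?thesis by (simp add: o_def)
  qed
  moreover have "(\<lambda>p. V (p + ?c)) = V"
    using V_shift by (auto simp: fun_eq_iff)
  ultimately have "V' ((x, \<tau>) + ?c) = V' (x, \<tau>)"
    using has_derivative_unique[OF _ V_deriv] by metis
  then show ?thesis by (simp add: rate_def transverse_field_shift)
qed

definition period_cell :: "((real^'m) \<times> real) set" where
  "period_cell = {p \<in> sublevel. snd p \<in> {0..T}}"

lemma compact_cell: "compact period_cell"
proof -
  obtain B where B: "\<And>p. p \<in> sublevel \<Longrightarrow> norm (fst p) \<le> B"
    using sublevel_bounded unfolding sublevel_def by blast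
  have "period_cell = sublevel \<inter> (cball 0 B \<times> {0..T})"
    using B by (auto simp: period_cell_def)
  then show ?thesis
    using closed_Int_compact[OF closed_sublevel compact_Times[OF compact_cball compact_Icc]] by simp
qed

lemma cell_subset: "period_cell \<subseteq> sublevel"
  by (auto simp: period_cell_def)

text \<open>
  The sublevel set is not compact since \<open>\<tau>\<close> ranges over the whole line. Everything of interest is
  periodic in \<open>\<tau>\<close>, so that bounds can be found on a compact period cell.
\<close>

lemma shift_to_cell:
  assumes "p \<in> sublevel"
  obtains q where "q \<in> period_cell" "fst q = fst p" "V q = V p" "rate q = rate p" "transverse_field q = transverse_field p"
proof -
  obtain k :: int where k: "snd p + of_int k * T \<in> {0..<T}"
    using T_pos by (rule shift_into_period)
  let ?q = "(fst p, snd p + of_int k * T)"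
  have "snd ?q \<in> {0..T}" using k by simp
  moreover have "V ?q = V p" "rate ?q = rate p" "transverse_field ?q = transverse_field p"
    by (simp_all only: V_shift rate_shift transverse_field_shift prod.collapse)
  ultimately show thesis
    using that[of ?q] assms by (auto simp: period_cell_def sublevel_def)
qed

lemma transverse_field_bounded:
  "\<exists>B\<ge>0. \<forall>p\<in>sublevel. norm (transverse_field p) \<le> B"
proof -
  have "bounded (transverse_field ` period_cell)"
    by (intro compact_imp_bounded compact_continuous_image compact_cell
        continuous_on_subset[OF continuous_on_transverse_field_sublevel cell_subset])
  then obtain B where B: "B > 0" "\<forall>q\<in>period_cell. norm (transverse_field q) \<le> B"
    unfolding bounded_pos by blast
  have "norm (transverse_field p) \<le> B" if "p \<in> sublevel" for p
    using that B(2) by (metis shift_to_cell)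
  then show ?thesis
    using B(1) by (intro exI[of _ B]) auto
qed

lemma uniform_positive_lower_bound:
  assumes S: "closed S" and g: "continuous_on (period_cell \<inter> S) g"
    and pos: "\<And>q. q \<in> period_cell \<inter> S \<Longrightarrow> g q > 0"
  obtains c where "(c :: real) > 0" "\<And>q. q \<in> period_cell \<inter> S \<Longrightarrow> c \<le> g q"
proof (cases "period_cell \<inter> S = {}")
  case True
  then show thesis using that[of 1] by simp
next
  case False
  have "compact (period_cell \<inter> S)" using compact_cell S by blast
  from continuous_attains_inf[OF this False g] obtain q
    where q: "q \<in> period_cell \<inter> S" "\<forall>q'\<in>period_cell \<inter> S. g q \<le> g q'" by blast
  show thesis
    using that[of "g q"] pos[OF q(1)] q(2) by blast
qed

lemma V_bounded_below_away_from_orbit: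
  assumes "\<rho> > 0"
  shows "\<exists>\<epsilon>>0. \<forall>p\<in>sublevel. norm (fst p) \<ge> \<rho> \<longrightarrow> V p \<ge> \<epsilon>"
proof -
  let ?S = "{q :: (real^'m) \<times> real. norm (fst q) \<ge> \<rho>}"
  have "closed ?S" by (intro closed_Collect_le continuous_intros)
  moreover have "V q > 0" if "q \<in> period_cell \<inter> ?S" for q
    using that assms by (intro V_pos) (auto simp: period_cell_def sublevel_def)
  ultimately obtain \<epsilon> where \<epsilon>: "\<epsilon> > 0" "\<And>q. q \<in> period_cell \<inter> ?S \<Longrightarrow> \<epsilon> \<le> V q"
    using uniform_positive_lower_bound[of ?S V] continuous_on_V by blast
  show ?thesis
  proof (intro exI[of _ \<epsilon>] conjI ballI impI \<epsilon>(1))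
    fix p assume p: "p \<in> sublevel" "norm (fst p) \<ge> \<rho>"
    obtain q where "q \<in> period_cell" "fst q = fst p" "V q = V p"
      using p(1) by (rule shift_to_cell)
    then show "V p \<ge> \<epsilon>" using \<epsilon>(2)[of q] p(2) by simp
  qed
qed

lemma rate_bounded_above_off_orbit:
  assumes "\<epsilon> > 0"
  shows "\<exists>c>0. \<forall>p\<in>sublevel. V p \<ge> \<epsilon> \<longrightarrow> rate p \<le> - c"
proof -
  let ?S = "{q. V q \<ge> \<epsilon>}"
  have "closed ?S" by (intro closed_Collect_le continuous_on_V continuous_intros)
  moreover have "- rate q > 0" if "q \<in> period_cell \<inter> ?S" for q
  proof -
    have "fst q \<noteq> 0" using that assms V_zero[of "snd q"] by (cases q) auto
    then show ?thesis
      using that V_decr[of q] by (simp add: period_cell_def sublevel_def rate_def)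
  qed
  moreover have "continuous_on (period_cell \<inter> ?S) (\<lambda>q. - rate q)"
    using cell_subset by (intro continuous_on_minus continuous_on_subset[OF continuous_on_rate]) auto
  ultimately obtain c where c: "c > 0" "\<And>q. q \<in> period_cell \<inter> ?S \<Longrightarrow> c \<le> - rate q"
    using uniform_positive_lower_bound[of ?S "\<lambda>q. - rate q"] by blast
  show ?thesis
  proof (intro exI[of _ c] conjI ballI impI c(1))
    fix p assume p: "p \<in> sublevel" "V p \<ge> \<epsilon>"
    obtain q where "q \<in> period_cell" "V q = V p" "rate q = rate p"
      using p(1) by (rule shift_to_cell)
    then show "rate p \<le> - c" using c(2)[of q] p(2) by simp
  qed
qed

lemma rate_nonpos: "p \<in> sublevel \<Longrightarrow> rate p \<le> 0"
  using V_decr[of p] V_stationary[of "snd p"]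
  by (cases "fst p = 0"; cases p) (auto simp: sublevel_def rate_def)

lemma V_nonneg: "p \<in> sublevel \<Longrightarrow> V p \<ge> 0"
  using V_pos[of p] V_zero[of "snd p"] by (cases "fst p = 0"; cases p) (auto simp: sublevel_def)

lemma V_along_curve:
  assumes "(p has_vector_derivative v) (at t within S)"
  shows "((\<lambda>t. V (p t)) has_real_derivative V' (p t) v) (at t within S)"
proof -
  have "((\<lambda>t. V (p t)) has_derivative (\<lambda>h. V' (p t) (h *\<^sub>R v))) (at t within S)"
    using assms V_deriv has_derivative_compose unfolding has_vector_derivative_def by blast
  moreover have "V' (p t) (h *\<^sub>R v) = V' (p t) v * h" for h
    using has_derivative_linear[OF V_deriv] by (simp add: linear_scale)
  ultimately show ?thesis by (simp add: has_field_derivative_def)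
qed

text \<open>
  The transverse system is solved by Peano's theorem, without uniqueness, so trajectories of different
  lengths need not extend each other; each is kept with its own final time.
\<close>

definition trajectory :: "(real \<Rightarrow> (real^'m) \<times> real) \<Rightarrow> real \<Rightarrow> bool" where
  "trajectory p b \<longleftrightarrow> solution_on transverse_field p {0..b} \<and> p ` {0..b} \<subseteq> sublevel"

text \<open>
  The vector field is extended from the closed sublevel set to a bounded continuous field. No solution
  of the extended equation leaves the sublevel set, because on the boundary \<open>V\<close> decreases strictly.
\<close>

lemma trajectory_exists:
  assumes p0: "p0 \<in> sublevel" and b: "b \<ge> 0"
  obtains p where "trajectory p b" "p 0 = p0"
proof -
  obtain B where B: "B \<ge> 0" "\<And>p. p \<in> sublevel \<Longrightarrow> norm (transverse_field p) \<le> B"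
    using transverse_field_bounded by blast
  have closed: "closedin (top_of_set UNIV) sublevel" using closed_sublevel by simp
  obtain G where G: "continuous_on UNIV G" "\<And>p. p \<in> sublevel \<Longrightarrow> G p = transverse_field p"
      "\<And>p. p \<in> UNIV \<Longrightarrow> norm (G p) \<le> B"
    by (rule Tietze[OF continuous_on_transverse_field_sublevel closed B(1)]) (use B(2) in blast)+
  obtain p where p: "solution_on G p {0..b}" "p 0 = p0"
    by (rule Peano_existence[OF G(1) _ b, of B p0]) (use G(3) in blast)+
  have deriv: "((\<lambda>t. V (p t)) has_real_derivative V' (p t) (G (p t))) (at t within {0..b})"
    if "t \<in> {0..b}" for t
    using p(1) that by (intro V_along_curve) (simp add: solution_on_def)
  have stays: "V (p t) \<le> 1" if "t \<in> {0..b}" for t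
  proof (rule barrier_stays_below[OF deriv _ _ that])
    show "V (p 0) \<le> 1" using p0 p(2) by (simp add: sublevel_def)
    fix s assume s: "V (p s) = 1"
    then have "fst (p s) \<noteq> 0" using V_zero[of "snd (p s)"] by (cases "p s") auto
    moreover have "p s \<in> sublevel" using s by (simp add: sublevel_def)
    ultimately show "V' (p s) (G (p s)) < 0"
      using V_decr[of "p s"] G(2) s by simp
  qed
  then have sub: "p t \<in> sublevel" if "t \<in> {0..b}" for t
    using that by (simp add: sublevel_def)
  then have "p ` {0..b} \<subseteq> sublevel" by blast
  moreover have "solution_on transverse_field p {0..b}"
    using p(1) G(2)[OF sub] by (simp add: solution_on_def)
  ultimately show thesis
    using that p(2) by (simp add: trajectory_def)
qed

lemma chart_trajectory:
  assumes "trajectory p b"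
  shows "solution_on f (\<lambda>t. chart (p t)) {0..b}"
  unfolding solution_on_def
proof
  fix t assume t: "t \<in> {0..b}"
  have p: "(p has_vector_derivative transverse_field (p t)) (at t within {0..b})" and "p t \<in> sublevel"
    using assms t by (auto simp: trajectory_def solution_on_def)
  then have denom: "denom (p t) \<noteq> 0"
    using denom_pos[of "p t"] by (simp add: sublevel_def)
  have "((\<lambda>t. chart (p t)) has_derivative (\<lambda>h. chart_deriv (p t) (h *\<^sub>R transverse_field (p t)))) (at t within {0..b})"
    using p has_derivative_chart has_derivative_compose unfolding has_vector_derivative_def by blast
  moreover have "chart_deriv (p t) (h *\<^sub>R transverse_field (p t)) = h *\<^sub>R f (chart (p t))" for h
    using has_derivative_linear[OF has_derivative_chart] chart_deriv_field[OF denom]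
    by (simp add: linear_scale)
  ultimately show "((\<lambda>t. chart (p t)) has_vector_derivative f (chart (p t))) (at t within {0..b})"
    by (simp add: has_vector_derivative_def)
qed

lemma flow_eq_chart_trajectory:
  assumes "trajectory p b" "t \<in> {0..b}"
  shows "flow f (chart (p 0)) t = chart (p t)"
  using flow_eq_solution[OF f_C1 chart_trajectory[OF assms(1)] assms(2)] .

text \<open>
  The waiting time is independent of the trajectory. This uniformity lets the trajectories on the
  different intervals \<open>[0, b]\<close>, which need not extend each other, serve for one limit.
\<close>

lemma V_small_along_trajectory:
  assumes "\<epsilon> > 0"
  shows "\<exists>t0. \<forall>p b. trajectory p b \<longrightarrow> t0 < b \<longrightarrow> V (p b) < \<epsilon>"
proof -
  obtain c where c: "c > 0" "\<And>p. p \<in> sublevel \<Longrightarrow> V p \<ge> \<epsilon> \<Longrightarrow> rate p \<le> - c"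
    using rate_bounded_above_off_orbit[OF assms] by blast
  show ?thesis
  proof (intro exI[of _ "1 / c"] allI impI, rule ccontr)
    fix p b assume traj: "trajectory p b" and b: "1 / c < b" and "\<not> V (p b) < \<epsilon>"
    have b0: "0 < b" using b c(1) by (meson divide_pos_pos less_trans zero_less_one)
    have mem: "p s \<in> sublevel" if "s \<in> {0..b}" for s
      using traj that by (auto simp: trajectory_def)
    have deriv: "((\<lambda>t. V (p t)) has_real_derivative rate (p s)) (at s within {0..b})"
      if "s \<in> {0..b}" for s
      unfolding rate_def using traj that
      by (intro V_along_curve) (simp add: trajectory_def solution_on_def)
    have mono: "V (p b) \<le> V (p s)" if s: "s \<in> {0..b}" for s
    proof -
      have "V (p b) \<le> V (p s) - 0 * (b - s)"
        by (rule deriv_le_imp_decrease[where u' = "\<lambda>s. rate (p s)"])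
          (use s in \<open>auto intro!: DERIV_subset[OF deriv] rate_nonpos mem\<close>)
      then show ?thesis by simp
    qed
    have "V (p b) \<le> V (p 0) - c * (b - 0)"
    proof (rule deriv_le_imp_decrease[where u' = "\<lambda>s. rate (p s)"])
      show "rate (p s) \<le> - c" if "s \<in> {0..b}" for s
        using c(2)[OF mem[OF that]] mono[OF that] \<open>\<not> V (p b) < \<epsilon>\<close> by linarith
    qed (use b0 deriv in auto)
    moreover have "V (p 0) \<le> 1" using mem[of 0] b0 by (simp add: sublevel_def)
    moreover have "1 < c * b" using b c(1) by (simp add: field_simps)
    ultimately show False using V_nonneg[OF mem[of b]] b0 by simp
  qed
qed

text \<open>
  \<open>P\<^sup>T\<close> is an isometry.
\<close>

lemma infdist_chart_le: "infdist (chart p) (orbit T xs) \<le> norm (fst p)"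
proof -
  have "xs (snd p) \<in> orbit T xs"
  proof -
    obtain k :: int where "snd p + of_int k * T \<in> {0..<T}"
      using T_pos by (rule shift_into_period)
    moreover have "xs (snd p) = xs (snd p + of_int k * T)" by (simp only: frame_shift)
    ultimately show ?thesis unfolding orbit_def by blast
  qed
  then have "infdist (chart p) (orbit T xs) \<le> dist (chart p) (xs (snd p))"
    by (rule infdist_le)
  also have "\<dots> = norm (transpose (P (snd p)) *v fst p)"
    by (simp add: chart_def transverse_point_def dist_norm)
  also have "\<dots> = norm (fst p)"
  proof -
    have "(transpose (P (snd p)) *v fst p) \<bullet> (transpose (P (snd p)) *v fst p)
        = fst p \<bullet> (P (snd p) *v (transpose (P (snd p)) *v fst p))"
      by (metis dot_lmul_matrix inner_commute transpose_matrix_vector)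
    then show ?thesis
      by (simp add: norm_eq_sqrt_inner orthonormal_rows_right_inverse[OF rows] del: transpose_matrix_vector)
  qed
  finally show ?thesis .
qed

text \<open>
  For each late time \<open>t\<close> a trajectory of length \<open>t\<close> is taken; all of them project to the same
  flow line.
\<close>

lemma flow_tends_to_orbit:
  assumes p0: "p0 \<in> sublevel"
  shows "((\<lambda>t. infdist (flow f (chart p0) t) (orbit T xs)) \<longlongrightarrow> 0) at_top"
proof (rule tendstoI)
  fix \<rho> :: real assume "\<rho> > 0"
  then obtain \<epsilon> where \<epsilon>: "\<epsilon> > 0" "\<And>p. p \<in> sublevel \<Longrightarrow> norm (fst p) \<ge> \<rho> \<Longrightarrow> V p \<ge> \<epsilon>"
    using V_bounded_below_away_from_orbit by blast
  obtain t0 where t0: "\<And>p b. trajectory p b \<Longrightarrow> t0 < b \<Longrightarrow> V (p b) < \<epsilon>"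
    using V_small_along_trajectory[OF \<epsilon>(1)] by blast
  have "dist (infdist (flow f (chart p0) t) (orbit T xs)) 0 < \<rho>" if t: "max 0 t0 < t" for t
  proof -
    obtain p where p: "trajectory p t" "p 0 = p0"
      using trajectory_exists[OF p0, of t] t by auto
    have "p t \<in> sublevel" using p(1) t by (auto simp: trajectory_def)
    then have "norm (fst (p t)) < \<rho>"
      using \<epsilon>(2)[of "p t"] t0[OF p(1)] t by force
    then show ?thesis
      using flow_eq_chart_trajectory[OF p(1), of t] p(2) t infdist_chart_le[of "p t"]
        infdist_nonneg[of "chart (p t)" "orbit T xs"] by simp
  qed
  then show "\<forall>\<^sub>F t in at_top. dist (infdist (flow f (chart p0) t) (orbit T xs)) 0 < \<rho>"
    using eventually_gt_at_top by (rule eventually_mono[rotated])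
qed

theorem inner_estimate_sublevel:
  "inner_estimate_region_of_stability f T xs (chart ` sublevel)"
  unfolding inner_estimate_region_of_stability_def
proof (intro conjI ballI)
  have "open {p. V p < 1}"
    by (intro open_Collect_less continuous_on_V continuous_on_const)
  then have "{p. V p < 1} \<subseteq> interior sublevel"
    by (intro interior_maximal) (auto simp: sublevel_def)
  then have "(0, \<tau>) \<in> interior sublevel" for \<tau>
    using V_zero by auto
  moreover have "denom (0, \<tau>) \<noteq> 0" for \<tau>
    using denom_pos[of "(0, \<tau>)"] V_zero by simp
  ultimately have xs_interior: "chart (0, \<tau>) \<in> interior (chart ` sublevel)" for \<tau>
    by (intro chart_interior)
  moreover have "chart (0, \<tau>) = xs \<tau>" for \<tau>
    by (simp add: chart_def transverse_point_def)
  ultimately show "orbit T xs \<subseteq> interior (chart ` sublevel)"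
    by (auto simp: orbit_def)
  show "interior (chart ` sublevel) \<noteq> {}"
    using xs_interior by blast
next
  fix x0 assume "x0 \<in> chart ` sublevel"
  then obtain p0 where p0: "p0 \<in> sublevel" "x0 = chart p0" by blast
  have ex: "\<exists>\<phi>. solution_on f \<phi> {0..b} \<and> \<phi> 0 = x0" if "b > 0" for b
  proof -
    have "0 \<le> b" using that by simp
    then obtain p where "trajectory p b" "p 0 = p0"
      by (rule trajectory_exists[OF p0(1)])
    then show ?thesis
      using chart_trajectory p0(2) by (intro exI[of _ "\<lambda>t. chart (p t)"]) simp
  qed
  show "\<exists>\<phi>. solution_on f \<phi> {0..} \<and> \<phi> 0 = x0"
    using flow_is_solution[OF f_C1 ex] by blast
  show "((\<lambda>t. infdist (flow f x0 t) (orbit T xs)) \<longlongrightarrow> 0) at_top"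
    using flow_tends_to_orbit[OF p0(1)] p0(2) by simp
qed

end

section \<open>Orbital stability\<close>

lemma Ck_1_curveE:
  fixes g :: "real \<Rightarrow> 'a::real_normed_vector"
  assumes "Ck 1 g"
  obtains g' where "\<And>t. (g has_vector_derivative g' t) (at t)" "continuous_on UNIV g'"
proof -
  obtain D where D: "\<And>t. (g has_derivative D t) (at t)" "\<And>v. continuous_on UNIV (\<lambda>t. D t v)"
    using assms by (rule Ck_1E) blast
  have "(g has_vector_derivative D t 1) (at t)" for t
  proof -
    have "D t h = h *\<^sub>R D t 1" for h
      using linear_scale[OF has_derivative_linear[OF D(1)], of t h 1] by simp
    then have "D t = (\<lambda>h. h *\<^sub>R D t 1)" by blast
    then show ?thesis
      using D(1)[of t] by (simp add: has_vector_derivative_def)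
  qed
  then show thesis
    using D(2)[of 1] by (rule that)
qed

text \<open>
  The total derivative splits into the two partial derivatives from which the rate of change is built.
\<close>

lemma dV_dt_eq_derivative:
  assumes V: "(V has_derivative V') (at (x, \<tau>))"
  shows "dV_dt f xs z P V x \<tau> = V' (perp_dot f xs z P x \<tau>, tau_dot f xs z P x \<tau>)"
proof -
  let ?u = "perp_dot f xs z P x \<tau>" and ?w = "tau_dot f xs z P x \<tau>"
  have lin: "linear V'" using V by (rule has_derivative_linear)
  have pair: "((\<lambda>\<sigma>. (x, \<sigma>)) has_derivative (\<lambda>h. (0, h))) (at \<tau>)"
    "((\<lambda>y. (y, \<tau>)) has_derivative (\<lambda>h. (h, 0))) (at x)"
    by (auto intro!: derivative_eq_intros)
  have scale: "V' (0, h) = V' (0, 1) * h" for h :: real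
    using linear_scale[OF lin, of h "(0, 1)"] by simp
  have "((\<lambda>\<sigma>. V (x, \<sigma>)) has_derivative (\<lambda>h. V' (0, h))) (at \<tau>)"
    using diff_chain_at[OF pair(1) V] by (simp add: o_def)
  then have "((\<lambda>\<sigma>. V (x, \<sigma>)) has_real_derivative V' (0, 1)) (at \<tau>)"
    by (rule has_derivative_imp_has_field_derivative) (metis scale mult.commute)
  then have d1: "deriv (\<lambda>\<sigma>. V (x, \<sigma>)) \<tau> = V' (0, 1)"
    by (rule DERIV_imp_deriv)
  have "((\<lambda>y. V (y, \<tau>)) has_derivative (\<lambda>h. V' (h, 0))) (at x)"
    using diff_chain_at[OF pair(2) V] by (simp add: o_def)
  then have d2: "frechet_derivative (\<lambda>y. V (y, \<tau>)) (at x) = (\<lambda>h. V' (h, 0))"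
    by (rule frechet_derivative_at[symmetric])
  have "V' (?u, ?w) = V' (0, ?w) + V' (?u, 0)"
    using linear_add[OF lin, of "(0, ?w)" "(?u, 0)"] by simp
  then show ?thesis
    using scale[of ?w] by (simp only: dV_dt_def d1 d2)
qed

lemma circle_class_eqD:
  assumes "circle_class T \<sigma> = circle_class T \<tau>"
  obtains k :: int where "\<sigma> = \<tau> + of_int k * T"
proof -
  have "\<sigma> = \<sigma> + of_int 0 * T" by simp
  then have "\<sigma> \<in> circle_class T \<sigma>" unfolding circle_class_def by blast
  then show thesis
    using that unfolding assms by (auto simp: circle_class_def)
qed

text \<open>
  Two representatives of a class on the circle differ by a multiple of the period.
\<close>

lemma mem_unit_sublevel_iff:
  assumes "\<forall>x. periodic T (\<lambda>\<tau>. V (x, \<tau>))"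
  shows "(x, circle_class T \<tau>) \<in> unit_sublevel T V \<longleftrightarrow> V (x, \<tau>) \<le> 1"
proof
  assume "(x, circle_class T \<tau>) \<in> unit_sublevel T V"
  then obtain \<sigma> where \<sigma>: "circle_class T \<sigma> = circle_class T \<tau>" "V (x, \<sigma>) \<le> 1"
    by (auto simp: unit_sublevel_def)
  obtain k :: int where "\<sigma> = \<tau> + of_int k * T"
    using \<sigma>(1) by (rule circle_class_eqD)
  moreover have "V (x, \<tau> + of_int k * T) = V (x, \<tau>)"
    by (rule periodic_int) (use assms in blast)
  ultimately show "V (x, \<tau>) \<le> 1"
    using \<sigma>(2) by simp
qed (auto simp: unit_sublevel_def)

text \<open>
  To be used for \<open>v \<tau> = V (0, \<tau>)\<close>, which is assumed to vanish only over those \<open>\<tau>\<close> where the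
  sublevel set has a point. The set \<open>{v \<le> 1} = {v < 1}\<close> is both closed and open, so it is the whole
  line once it contains some \<open>\<sigma>\<close>.
\<close>

lemma zero_everywhere_if_zero_on_sublevel:
  fixes v :: "real \<Rightarrow> real"
  assumes v: "continuous_on UNIV v" and zero: "\<And>\<tau>. v \<tau> \<le> 1 \<Longrightarrow> v \<tau> = 0" and "v \<sigma> \<le> 1"
  shows "v \<tau> = 0"
proof -
  have "{\<tau>. v \<tau> \<le> 1} = {\<tau>. v \<tau> < 1}"
  proof (intro Collect_cong iffI)
    show "v \<tau> < 1" if "v \<tau> \<le> 1" for \<tau>
      using zero[OF that] by simp
  qed simp
  moreover have "open {\<tau>. v \<tau> < 1}" "closed {\<tau>. v \<tau> \<le> 1}"
    by (intro open_Collect_less closed_Collect_le v continuous_on_const)+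
  ultimately have "{\<tau>. v \<tau> \<le> 1} = {} \<or> {\<tau>. v \<tau> \<le> 1} = UNIV"
    using clopen[of "{\<tau>. v \<tau> \<le> 1}"] by simp
  then show ?thesis
    using assms(3) zero by blast
qed

theorem theorem2:
  fixes f :: "real^'n \<Rightarrow> real^'n"
    and xs z :: "real \<Rightarrow> real^'n"
    and T :: real
    and e :: "nat \<Rightarrow> 'n"
    and r :: "'m::finite \<Rightarrow> nat"
    and \<eta> :: "nat \<Rightarrow> real^'n"
    and P :: "real \<Rightarrow> real^'n^'m"
    and V :: "(real^'m) \<times> real \<Rightarrow> real"
    and D :: "((real^'m) \<times> real set) set"
  assumes dim: "CARD('n) \<ge> 2"
    and coords: "bij_betw e {1..CARD('n)} UNIV"
    and rows: "bij_betw r UNIV {2..CARD('n)}"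
    and smooth_f: "smooth f"
    and xs: "nontrivial_periodic_solution f T xs"
    and nonzero: "\<forall>t. f (xs t) \<noteq> 0"
    and z: "transversal_normal_field f T xs z"
    and basis: "CARD('n) \<ge> 3 \<Longrightarrow> orthonormal_basis \<eta>"
    and not_collinear: "CARD('n) \<ge> 3 \<Longrightarrow> \<forall>\<tau>. \<not> collinear {0, \<eta> 1, z \<tau>}"
    and P: "P = projection_operator e r \<eta> z"
    and C1_V: "Ck 1 V"
    and periodic_V: "\<forall>x. periodic T (\<lambda>\<tau>. V (x, \<tau>))"
    and D: "D = unit_sublevel T V"
    and D_nonempty: "D \<noteq> {}"
    and D_compact: "compactin (prod_topology euclidean (circle_topology T)) D"
    and V_pos: "\<forall>x \<tau>. (x, circle_class T \<tau>) \<in> D \<longrightarrow> x \<noteq> 0 \<longrightarrow> V (x, \<tau>) > 0"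
    and dV_neg: "\<forall>x \<tau>. (x, circle_class T \<tau>) \<in> D \<longrightarrow> x \<noteq> 0 \<longrightarrow> dV_dt f xs z P V x \<tau> < 0"
    and V_zero: "\<forall>x \<tau>. (x, circle_class T \<tau>) \<in> D \<longrightarrow>
                   V (0, \<tau>) = 0 \<and> dV_dt f xs z P V 0 \<tau> = 0"
    and well_defined: "\<forall>x \<tau>. (x, circle_class T \<tau>) \<in> D \<longrightarrow>
                   z \<tau> \<bullet> f (xs \<tau>) - vector_derivative z (at \<tau>) \<bullet> (transpose (P \<tau>) *v x) > 0"
  shows "inner_estimate_region_of_stability f T xs
           {xs \<tau> + transpose (P \<tau>) *v x | x \<tau>. (x, circle_class T \<tau>) \<in> D}"
proof -
  have f_C1: "Ck 1 f" using smooth_f by (simp only: smooth_def)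
  obtain z' where z': "\<And>\<tau>. (z has_vector_derivative z' \<tau>) (at \<tau>)" "continuous_on UNIV z'"
  proof -
    have "Ck 1 z" using z by (simp only: transversal_normal_field_def smooth_def)
    then show thesis using that by (rule Ck_1_curveE) blast
  qed
  have z_norm: "norm (z \<tau>) = 1" for \<tau>
    using z by (simp add: transversal_normal_field_def)
  have z_periodic: "periodic T z"
    using z by (simp add: transversal_normal_field_def)
  have not_collinear': "1 + \<eta> 1 \<bullet> z \<tau> \<noteq> 0" if "CARD('n) \<noteq> 2" for \<tau>
  proof -
    have n: "CARD('n) \<ge> 3" using dim that by simp
    then have "norm (\<eta> 1) = 1"
      using basis by (simp add: orthonormal_basis_def norm_eq_1)
    then show ?thesis
      using not_collinear_inner_neq z_norm not_collinear[OF n] by blast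
  qed
  have "\<exists>P'. (\<forall>\<tau>. (P has_vector_derivative P' \<tau>) (at \<tau>)) \<and> continuous_on UNIV P'"
    unfolding P by (rule projection_operator_C1[of z z' \<eta> e r, OF z']) (use not_collinear' in blast)
  then obtain P' where P': "\<And>\<tau>. (P has_vector_derivative P' \<tau>) (at \<tau>)" "continuous_on UNIV P'"
    by blast
  have rows_orthonormal: "P \<tau> $ k \<bullet> P \<tau> $ l = (if k = l then 1 else 0)" "z \<tau> \<bullet> P \<tau> $ k = 0" for \<tau> k l
    unfolding P
    by (rule projection_operator_orthonormal[OF dim coords rows z_norm basis];
        use not_collinear in blast)+
  have card: "CARD('n) = Suc (CARD('m))"
    using bij_betw_same_card[OF rows] dim by simp
  obtain V' where V': "\<And>p. (V has_derivative V' p) (at p)" "\<And>v. continuous_on UNIV (\<lambda>p. V' p v)"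
    using C1_V by (rule Ck_1E) blast
  have V_cont: "continuous_on UNIV V"
    using V'(1) by (blast intro: continuous_at_imp_continuous_on has_derivative_continuous)
  have D_iff: "(x, circle_class T \<tau>) \<in> D \<longleftrightarrow> V (x, \<tau>) \<le> 1" for x \<tau>
    unfolding D by (rule mem_unit_sublevel_iff[OF periodic_V])
  have V_zero': "V (0, \<tau>) = 0" for \<tau>
  proof -
    obtain x \<sigma> where "V (x, \<sigma>) \<le> 1"
      using D_nonempty unfolding D unit_sublevel_def by blast
    then have "V (0, \<sigma>) = 0" using V_zero unfolding D_iff by blast
    then have at_\<sigma>: "V (0, \<sigma>) \<le> 1" by simp
    have zero: "V (0, \<tau>) = 0" if "V (0, \<tau>) \<le> 1" for \<tau>
      using V_zero that unfolding D_iff by blast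
    have cont: "continuous_on UNIV (\<lambda>\<tau>. V (0, \<tau>))"
      by (rule continuous_on_compose2[OF V_cont _ subset_UNIV])
        (intro continuous_on_Pair continuous_on_const continuous_on_id)
    show ?thesis
      by (rule zero_everywhere_if_zero_on_sublevel[OF cont zero at_\<sigma>])
  qed
  have "compactin euclidean (fst ` D)"
    by (rule image_compactin[OF D_compact continuous_map_fst])
  then have "bounded (fst ` D)"
    by (simp add: compact_imp_bounded)
  then obtain B where B: "\<And>q. q \<in> D \<Longrightarrow> norm (fst q) \<le> B"
    by (auto simp: bounded_iff)
  have xs_sol: "(xs has_vector_derivative f (xs \<tau>)) (at \<tau>)" for \<tau>
    using xs by (simp add: nontrivial_periodic_solution_def solution_on_def)
  have f_cont: "continuous_on UNIV f"
    using f_C1 by (rule Ck_1E) (blast intro: continuous_at_imp_continuous_on has_derivative_continuous)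
  interpret transverse_frame f xs z z' P P' T
    using xs f_cont xs_sol z' P' z_periodic z_norm rows_orthonormal card
      projection_operator_periodic[OF z_periodic]
    by unfold_locales (auto simp: nontrivial_periodic_solution_def P)
  have rate: "V' (x, \<tau>) (transverse_field (x, \<tau>)) = dV_dt f xs z P V x \<tau>" for x \<tau>
    by (simp add: transverse_field_def dV_dt_eq_derivative[OF V'(1)])
  interpret transverse_lyapunov f xs z z' P P' T V V'
  proof unfold_locales
    show "\<exists>B. \<forall>p. V p \<le> 1 \<longrightarrow> norm (fst p) \<le> B"
    proof (intro exI allI impI)
      fix p assume "V p \<le> 1"
      then have "(fst p, circle_class T (snd p)) \<in> D" by (simp add: D_iff)
      from B[OF this] show "norm (fst p) \<le> B" by simp
    qed
    show "V p > 0" if "V p \<le> 1" "fst p \<noteq> 0" for p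
      using that V_pos D_iff by (cases p) auto
    show "V' p (transverse_field p) < 0" if "V p \<le> 1" "fst p \<noteq> 0" for p
      using that dV_neg D_iff rate by (cases p) auto
    show "V' (0, \<tau>) (transverse_field (0, \<tau>)) = 0" for \<tau>
    proof -
      have "(0, circle_class T \<tau>) \<in> D" by (simp add: D_iff V_zero')
      then show ?thesis using V_zero rate by simp
    qed
    show "denom p > 0" if "V p \<le> 1" for p
      using that well_defined D_iff by (cases p) (simp add: denom_def transverse_denominator_def)
    show "Ck 1 f" by (rule f_C1)
    show "periodic T (\<lambda>\<tau>. V (x, \<tau>))" for x using periodic_V by blast
  qed (rule V' V_zero')+
  have "{xs \<tau> + transpose (P \<tau>) *v x | x \<tau>. (x, circle_class T \<tau>) \<in> D}
      = {chart (x, \<tau>) | x \<tau>. (x, \<tau>) \<in> sublevel}"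
    by (simp only: D_iff sublevel_def chart_def transverse_point_def fst_conv snd_conv mem_Collect_eq)
  also have "\<dots> = chart ` sublevel"
    by auto
  finally show ?thesis
    by (simp only: inner_estimate_sublevel)
qed

end
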